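(* Let $\{Z_n\}_{n\ge0}$ be the one-dimensional ($d=1$) branching random walk described in the context, with offspring mean $m=1$ and offspring variance $\sigma^2<\infty$. Suppose that $\mathbb{E}[|X|^{\alpha}]<\infty$ for some $\alpha>2$. Then for every $r>0$, $$\lim_{n\to\infty}\mathbb{P}\left(\frac{R_n}{n}\ge r\right)=e^{-\frac{4r}{\sigma^2}}.$$
   Context: Let $\{p_k\}_{k\ge0}$ be an offspring distribution on $\{0,1,2,\dots\}$ with $p_0<1$, $p_1<1$, mean $m=\sum_k kp_k$ and variance $\sigma^2=\sum_k k^2p_k-m^2$. Let $X$ be an $\mathbb{R}^d$-valued random vector (the displacement) with mean zero whose components are i.i.d. The branching random walk $\{Z_n\}_{n\ge0}$ is a point-measure-valued process: $Z_0$ is a Poisson random measure on $\mathbb{R}^d$ with Lebesgue intensity (this law is denoted $\mathbb{P}$); at each generation every particle independently dies and is replaced by a random number of children with law $\{p_k\}$, and each child independently is displaced from its parent's position by an independent copy of $X$; $Z_n$ is the counting measure of particle positions at generation $n$. Let $B(u)=\{x\in\mathbb{R}^d:|x|<u\}$ and $R_n:=\sup\{u>0: Z_n(B(u))=0\}$ (with $\sup\emptyset=0$), the radius of the largest empty ball centered at the origin at time $n$. *)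

theory Defs
  imports "HOL-Probability.Probability"
begin

text \<open>Branching random walk in dimension 1, built on Ulam-Harris labels.
  Initial particles are enumerated as \<open>\<xi> i\<close> (i :: nat); the descendants of
  initial particle i are labelled by lists v :: nat list.  \<open>K i v\<close> is the
  number of children of the particle with label v in tree i, and \<open>D i v\<close> is the
  displacement of the particle v (v nonempty) relative to its parent.\<close>

definition gen_particles :: "(nat \<Rightarrow> nat list \<Rightarrow> 'a \<Rightarrow> nat) \<Rightarrow> nat \<Rightarrow> nat \<Rightarrow> 'a \<Rightarrow> nat list set" where
  "gen_particles K i n \<omega> = {v. length v = n \<and> (\<forall>j<n. v ! j < K i (take j v) \<omega>)}"

definition particle_pos :: "(nat \<Rightarrow> 'a \<Rightarrow> real) \<Rightarrow> (nat \<Rightarrow> nat list \<Rightarrow> 'a \<Rightarrow> real) \<Rightarrow> nat \<Rightarrow> nat list \<Rightarrow> 'a \<Rightarrow> real" where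
  "particle_pos \<xi> D i v \<omega> = \<xi> i \<omega> + (\<Sum>j<length v. D i (take (Suc j) v) \<omega>)"

definition brw_Z :: "(nat \<Rightarrow> 'a \<Rightarrow> real) \<Rightarrow> (nat \<Rightarrow> nat list \<Rightarrow> 'a \<Rightarrow> nat) \<Rightarrow> (nat \<Rightarrow> nat list \<Rightarrow> 'a \<Rightarrow> real)
    \<Rightarrow> nat \<Rightarrow> 'a \<Rightarrow> real set \<Rightarrow> ennreal" where
  "brw_Z \<xi> K D n \<omega> A = emeasure (count_space UNIV)
     {(i, v). v \<in> gen_particles K i n \<omega> \<and> particle_pos \<xi> D i v \<omega> \<in> A}"

definition brw_R :: "(nat \<Rightarrow> 'a \<Rightarrow> real) \<Rightarrow> (nat \<Rightarrow> nat list \<Rightarrow> 'a \<Rightarrow> nat) \<Rightarrow> (nat \<Rightarrow> nat list \<Rightarrow> 'a \<Rightarrow> real)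
    \<Rightarrow> nat \<Rightarrow> 'a \<Rightarrow> ereal" where
  "brw_R \<xi> K D n \<omega> = Sup (insert 0 (ereal ` {u. 0 < u \<and> brw_Z \<xi> K D n \<omega> (ball 0 u) = 0}))"

definition poisson_point_seq :: "'a measure \<Rightarrow> (nat \<Rightarrow> 'a \<Rightarrow> real) \<Rightarrow> bool" where
  "poisson_point_seq M \<xi> \<longleftrightarrow>
     (\<forall>i. \<xi> i \<in> borel_measurable M) \<and>
     (\<forall>A. A \<in> sets borel \<and> bounded A \<longrightarrow>
        (AE \<omega> in M. finite {i. \<xi> i \<omega> \<in> A}) \<and>
        distr M (count_space UNIV) (\<lambda>\<omega>. card {i. \<xi> i \<omega> \<in> A})
          = measure_pmf (poisson_pmf (measure lborel A))) \<and>
     (\<forall>(k::nat) (A :: nat \<Rightarrow> real set).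
        (\<forall>j<k. A j \<in> sets borel \<and> bounded (A j)) \<and> disjoint_family_on A {..<k} \<longrightarrow>
        prob_space.indep_vars M (\<lambda>_. count_space UNIV) (\<lambda>j \<omega>. card {i. \<xi> i \<omega> \<in> A j}) {..<k})"

end

theory Submission
  imports Defs "HOL-Real_Asymp.Real_Asymp"
begin

text \<open>Since the radius is at least \<open>r n\<close> iff no particle of generation \<open>n\<close> lies in the ball of
  radius \<open>r n\<close>, the claim is about an empty ball. By Kolmogorov's estimate a critical tree survives
  to generation \<open>n\<close> with probability \<open>\<sim> 2 / (\<sigma>\<^sup>2 n)\<close>. The expected number of particles
  of one tree in generation \<open>n\<close> displaced by more than \<open>\<epsilon> n\<close> equals the probability that a
  random walk is displaced that far, which is \<open>o(1/n)\<close> by the Fuk--Nagaev inequality, because more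
  than two moments are finite. Hence up to negligible events the ball of radius \<open>r n\<close> is empty iff
  all trees rooted within distance \<open>(r \<plusminus> \<epsilon>) n\<close> are extinct. The number of these trees is
  Poisson with mean \<open>2 (r \<plusminus> \<epsilon>) n\<close>, so this event has probability asymptotic to
  \<open>exp (- 2 (r \<plusminus> \<epsilon>) n \<sqdot> 2 / (\<sigma>\<^sup>2 n))\<close>.\<close>

subsection \<open>Probability generating functions\<close>

definition pgf :: "nat pmf \<Rightarrow> real \<Rightarrow> real" where
  "pgf p s = measure_pmf.expectation p (\<lambda>k. s ^ k)"

lemma integrable_pgf:
  fixes s :: real
  assumes "0 \<le> s" "s \<le> 1"
  shows "integrable (measure_pmf p) (\<lambda>k. s ^ k)"
  using assms by (intro measure_pmf.integrable_const_bound[where B = 1]) (auto intro: power_le_one)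

lemma nn_integral_pgf:
  assumes "0 \<le> s" "s \<le> 1"
  shows "(\<integral>\<^sup>+k. ennreal (s ^ k) \<partial>measure_pmf p) = ennreal (pgf p s)"
  unfolding pgf_def using assms by (intro nn_integral_eq_integral integrable_pgf) auto

lemma pgf_nonneg: "0 \<le> s \<Longrightarrow> 0 \<le> pgf p s"
  by (simp add: pgf_def)

lemma pgf_le:
  assumes "0 \<le> s" "s \<le> 1"
  shows "pgf p s \<le> s + (1 - s) * pmf p 0"
proof -
  have "s ^ k \<le> s + (1 - s) * indicator {0} k" for k
    using assms power_decreasing[of 1 k s] by (cases "k = 0") auto
  moreover have "integrable (measure_pmf p) (\<lambda>k. s + (1 - s) * indicator {0} k)"
    using assms
    by (intro measure_pmf.integrable_const_bound[where B = 1]) (auto simp: indicator_def)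
  ultimately have "pgf p s \<le> measure_pmf.expectation p (\<lambda>k. s + (1 - s) * indicator {0} k)"
    unfolding pgf_def using assms by (intro integral_mono integrable_pgf)
  also have "\<dots> = s + (1 - s) * pmf p 0"
    by (subst Bochner_Integration.integral_add)
      (auto simp: measure_pmf_single intro!: measure_pmf.integrable_const_bound[where B = 1])
  finally show ?thesis .
qed

lemma pgf_poisson:
  assumes rate: "0 < rate" and s: "0 \<le> s" "s \<le> 1"
  shows "pgf (poisson_pmf rate) s = exp (- (1 - s) * rate)"
proof -
  have "(\<lambda>k. (s * rate) ^ k /\<^sub>R fact k * exp (- rate)) sums (exp (s * rate) * exp (- rate))"
    by (intro sums_mult2 exp_converges)
  then have "(\<lambda>k. pmf (poisson_pmf rate) k * s ^ k) sums exp (- (1 - s) * rate)"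
    using rate by (simp add: power_mult_distrib field_simps flip: exp_add)
  then have "(\<Sum>k. ennreal (pmf (poisson_pmf rate) k * s ^ k)) = ennreal (exp (- (1 - s) * rate))"
    using s by (intro suminf_ennreal_eq) auto
  then have "ennreal (pgf (poisson_pmf rate) s) = ennreal (exp (- (1 - s) * rate))"
    using s by (simp add: nn_integral_measure_pmf nn_integral_count_space_nat ennreal_mult
        flip: nn_integral_pgf)
  then show ?thesis using s by (simp add: pgf_nonneg)
qed

lemma nn_integral_poisson_mean:
  assumes rate: "0 < rate"
  shows "(\<integral>\<^sup>+k. of_nat k \<partial>measure_pmf (poisson_pmf rate)) = ennreal rate"
proof -
  have size_biased: "rate ^ k /\<^sub>R fact k * (rate * exp (- rate))
      = real (Suc k) * pmf (poisson_pmf rate) (Suc k)" for k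
  proof -
    have "real (Suc k) / fact (Suc k) = inverse (fact k)"
      by (simp add: fact_Suc divide_inverse del: of_nat_Suc)
    then have "real (Suc k) * (rate ^ Suc k / fact (Suc k) * exp (- rate))
        = inverse (fact k) * (rate ^ Suc k * exp (- rate))"
      by (metis mult.assoc mult.commute times_divide_eq_left)
    then show ?thesis using rate by (simp add: mult_ac del: of_nat_Suc fact_Suc)
  qed
  have "(\<lambda>k. rate ^ k /\<^sub>R fact k * (rate * exp (- rate))) sums (exp rate * (rate * exp (- rate)))"
    by (intro sums_mult2 exp_converges)
  also have "exp rate * (rate * exp (- rate)) = rate" by (simp add: exp_minus)
  finally have "(\<lambda>k. real k * pmf (poisson_pmf rate) k) sums rate"
    unfolding size_biased by (subst (asm) sums_Suc_iff) simp
  then have "(\<Sum>k. ennreal (real k * pmf (poisson_pmf rate) k)) = ennreal rate"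
    by (intro suminf_ennreal_eq) auto
  then show ?thesis
    by (simp add: nn_integral_measure_pmf nn_integral_count_space_nat ennreal_mult
        ennreal_of_nat_eq_real_of_nat mult.commute)
qed

subsection \<open>Survival of critical branching processes\<close>

lemma tendsto_Cesaro_mean:
  fixes a :: "nat \<Rightarrow> 'a :: real_normed_vector"
  assumes "a \<longlonglongrightarrow> L"
  shows "(\<lambda>n. (\<Sum>j<n. a j) /\<^sub>R real n) \<longlonglongrightarrow> L"
proof (rule tendstoI)
  fix e :: real assume "0 < e"
  then obtain N where N: "norm (a j - L) < e / 2" if "N \<le> j" for j
    using metric_LIMSEQ_D[OF assms, of "e / 2"] by (auto simp: dist_norm)
  define C where "C = (\<Sum>j<N. norm (a j - L))"
  have "\<forall>\<^sub>F n in sequentially. C / real n < e / 2"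
    using \<open>0 < e\<close> by (intro order_tendstoD(2)[OF lim_const_over_n]) auto
  then show "\<forall>\<^sub>F n in sequentially. dist ((\<Sum>j<n. a j) /\<^sub>R real n) L < e"
    using eventually_ge_at_top[of N] eventually_gt_at_top[of 0]
  proof eventually_elim
    case (elim n)
    have "norm (\<Sum>j<n. a j - L) \<le> (\<Sum>j<n. norm (a j - L))" by (rule norm_sum)
    also have "\<dots> = C + (\<Sum>j=N..<n. norm (a j - L))"
      using elim unfolding C_def lessThan_atLeast0 by (simp add: sum.atLeastLessThan_concat)
    also have "(\<Sum>j=N..<n. norm (a j - L)) \<le> real (n - N) * (e / 2)"
      using sum_mono[of "{N..<n}" "\<lambda>j. norm (a j - L)" "\<lambda>_. e / 2"] N by (simp add: less_imp_le)
    also have "\<dots> \<le> real n * (e / 2)"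
      using \<open>0 < e\<close> by (intro mult_right_mono) auto
    finally have "norm (\<Sum>j<n. a j - L) / real n \<le> C / real n + e / 2"
      using elim by (simp add: field_simps)
    moreover have "(\<Sum>j<n. a j) /\<^sub>R real n - L = (\<Sum>j<n. a j - L) /\<^sub>R real n"
      using elim by (simp add: sum_subtractf scaleR_diff_right sum_constant_scaleR)
    then have "dist ((\<Sum>j<n. a j) /\<^sub>R real n) L = norm (\<Sum>j<n. a j - L) / real n"
      by (simp add: dist_norm divide_real_def mult.commute)
    ultimately show ?case using elim by linarith
  qed
qed

lemma tendsto_of_nat_mult_if_tendsto_inverse_diff:
  fixes u :: "nat \<Rightarrow> real"
  assumes "(\<lambda>n. 1 / u (Suc n) - 1 / u n) \<longlonglongrightarrow> L" "L \<noteq> 0"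
  shows "(\<lambda>n. real n * u n) \<longlonglongrightarrow> 1 / L"
proof -
  have "(\<lambda>n. 1 / u 0 / real n + (\<Sum>j<n. 1 / u (Suc j) - 1 / u j) /\<^sub>R real n) \<longlonglongrightarrow> 0 + L"
    by (intro tendsto_add tendsto_Cesaro_mean lim_const_over_n assms)
  moreover have "1 / u 0 / real n + (\<Sum>j<n. 1 / u (Suc j) - 1 / u j) /\<^sub>R real n
      = inverse (real n * u n)" for n
    by (subst sum_lessThan_telescope) (simp add: divide_simps)
  ultimately have "(\<lambda>n. inverse (real n * u n)) \<longlonglongrightarrow> L" by simp
  from tendsto_inverse[OF this assms(2)] show ?thesis by (simp add: inverse_eq_divide)
qed

text \<open>\<open>((1 - u) ^ k - 1 + k u) / u\<^sup>2\<close>, in a form that also makes sense at \<open>u = 0\<close>\<close>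

fun binom_remainder :: "nat \<Rightarrow> real \<Rightarrow> real" where
  "binom_remainder 0 u = 0"
| "binom_remainder (Suc k) u = (1 - u) * binom_remainder k u + real k"

lemma power_one_minus_eq_binom_remainder:
  "(1 - u) ^ k = 1 - real k * u + u\<^sup>2 * binom_remainder k u"
proof (induction k)
  case (Suc k)
  show ?case by (simp add: Suc algebra_simps power2_eq_square)
qed simp

lemma binom_remainder_nonneg:
  assumes "0 \<le> u" "u \<le> 1"
  shows "0 \<le> binom_remainder k u"
  using assms by (induction k) simp_all

lemma binom_remainder_le:
  assumes "0 \<le> u" "u \<le> 1"
  shows "binom_remainder k u \<le> real k * (real k - 1) / 2"
proof (induction k)
  case (Suc k)
  have "(1 - u) * binom_remainder k u \<le> 1 * binom_remainder k u"
    using assms binom_remainder_nonneg[OF assms, of k] by (intro mult_right_mono) auto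
  with Suc show ?case by (simp add: field_simps)
qed simp

lemma binom_remainder_ge_1:
  assumes "0 \<le> u" "u \<le> 1" "2 \<le> k"
  shows "1 \<le> binom_remainder k u"
proof -
  obtain j where "k = Suc j" "1 \<le> j" using assms by (cases k) auto
  with binom_remainder_nonneg[OF assms(1,2), of j] assms show ?thesis
    by (simp add: add_increasing)
qed

lemma tendsto_binom_remainder:
  assumes "u \<longlonglongrightarrow> 0"
  shows "(\<lambda>n. binom_remainder k (u n)) \<longlonglongrightarrow> real k * (real k - 1) / 2"
proof (induction k)
  case (Suc k)
  have "(\<lambda>n. (1 - u n) * binom_remainder k (u n) + real k)
      \<longlonglongrightarrow> (1 - 0) * (real k * (real k - 1) / 2) + real k"
    by (intro tendsto_intros assms Suc)
  then show ?case by (simp add: field_simps)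
qed simp

locale critical_offspring =
  fixes p :: "nat pmf"
  assumes pmf_0_less_1: "pmf p 0 < 1" and pmf_1_less_1: "pmf p 1 < 1"
    and integrable_offspring: "integrable (measure_pmf p) real"
    and mean_offspring: "measure_pmf.expectation p real = 1"
    and integrable_offspring_sq: "integrable (measure_pmf p) (\<lambda>k. (real k)\<^sup>2)"
begin

abbreviation offspring_var :: real where
  "offspring_var \<equiv> measure_pmf.variance p real"

lemma offspring_var_eq: "offspring_var = measure_pmf.expectation p (\<lambda>k. real k * (real k - 1))"
proof -
  have "offspring_var = measure_pmf.expectation p (\<lambda>k. (real k)\<^sup>2) - measure_pmf.expectation p real"
    using integrable_offspring integrable_offspring_sq
    by (subst measure_pmf.variance_eq) (simp_all add: mean_offspring)
  also have "\<dots> = measure_pmf.expectation p (\<lambda>k. (real k)\<^sup>2 - real k)"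
    using integrable_offspring integrable_offspring_sq by simp
  finally show ?thesis by (simp add: power2_eq_square algebra_simps)
qed

lemma nn_integral_offspring: "(\<integral>\<^sup>+k. of_nat k \<partial>measure_pmf p) = 1"
  using nn_integral_eq_integral[OF integrable_offspring]
  by (simp add: mean_offspring ennreal_of_nat_eq_real_of_nat)

lemma integrable_factorial_moment: "integrable (measure_pmf p) (\<lambda>k. real k * (real k - 1) / 2)"
proof -
  have "integrable (measure_pmf p) (\<lambda>k. ((real k)\<^sup>2 - real k) / 2)"
    using integrable_offspring integrable_offspring_sq by auto
  then show ?thesis by (simp add: power2_eq_square algebra_simps)
qed

lemma prob_ge_2_pos: "0 < measure_pmf.prob p {2..}"
proof (rule ccontr)
  assume "\<not> ?thesis"
  then have "measure_pmf.prob p {2..} = 0" using measure_nonneg[of p "{2..}"] by linarith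
  then have "set_pmf p \<inter> {2..} = {}" by (simp add: measure_pmf_zero_iff)
  then have "set_pmf p \<subseteq> {..<2}" by auto
  then have "measure_pmf.expectation p real = (\<Sum>k<2. real k * pmf p k)"
    by (subst integral_measure_pmf[of "{..<2}"]) (auto simp: mult.commute)
  also have "\<dots> = pmf p 1" by (simp add: numeral_2_eq_2)
  finally show False using pmf_1_less_1 mean_offspring by simp
qed

definition pgf_remainder :: "real \<Rightarrow> real" where
  "pgf_remainder u = measure_pmf.expectation p (\<lambda>k. binom_remainder k u)"

lemma integrable_binom_remainder:
  assumes "0 \<le> u" "u \<le> 1"
  shows "integrable (measure_pmf p) (\<lambda>k. binom_remainder k u)"
proof (rule Bochner_Integration.integrable_bound[OF integrable_factorial_moment])
  have "norm (binom_remainder k u) \<le> norm (real k * (real k - 1) / 2)" for k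
    using binom_remainder_nonneg[OF assms, of k] binom_remainder_le[OF assms, of k]
    unfolding real_norm_def by linarith
  then show "AE k in measure_pmf p. norm (binom_remainder k u) \<le> norm (real k * (real k - 1) / 2)"
    by simp
qed simp

lemma pgf_one_minus:
  assumes "0 \<le> u" "u \<le> 1"
  shows "pgf p (1 - u) = 1 - u + u\<^sup>2 * pgf_remainder u"
  unfolding pgf_def power_one_minus_eq_binom_remainder pgf_remainder_def
  using integrable_offspring integrable_binom_remainder[OF assms] by (simp add: mean_offspring)

lemma pgf_remainder_ge:
  assumes "0 \<le> u" "u \<le> 1"
  shows "measure_pmf.prob p {2..} \<le> pgf_remainder u"
proof -
  have "measure_pmf.prob p {2..} = measure_pmf.expectation p (indicator {2..})" by simp
  also have "\<dots> \<le> pgf_remainder u"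
    unfolding pgf_remainder_def
    using binom_remainder_nonneg[OF assms] binom_remainder_ge_1[OF assms]
    by (intro integral_mono integrable_binom_remainder assms)
      (auto simp: indicator_def intro!: measure_pmf.integrable_const_bound[where B = 1])
  finally show ?thesis .
qed

lemma tendsto_pgf_remainder:
  assumes "u \<longlonglongrightarrow> 0" "\<And>n. 0 \<le> u n" "\<And>n. u n \<le> 1"
  shows "(\<lambda>n. pgf_remainder (u n)) \<longlonglongrightarrow> offspring_var / 2"
proof -
  have "norm (binom_remainder k (u n)) \<le> real k * (real k - 1) / 2" for k n
    using assms
    by (simp only: real_norm_def abs_of_nonneg binom_remainder_nonneg binom_remainder_le)
  then have "(\<lambda>n. measure_pmf.expectation p (\<lambda>k. binom_remainder k (u n)))
      \<longlonglongrightarrow> measure_pmf.expectation p (\<lambda>k. real k * (real k - 1) / 2)"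
    by (intro integral_dominated_convergence[OF _ _ integrable_factorial_moment]
        AE_I2 tendsto_binom_remainder assms(1)) auto
  then show ?thesis by (simp add: pgf_remainder_def offspring_var_eq)
qed

lemma offspring_var_pos: "0 < offspring_var"
proof -
  have "(\<lambda>n. pgf_remainder 0) \<longlonglongrightarrow> offspring_var / 2"
    by (rule tendsto_pgf_remainder) auto
  then have "pgf_remainder 0 = offspring_var / 2"
    by (simp add: LIMSEQ_const_iff)
  then show ?thesis using pgf_remainder_ge[of 0] prob_ge_2_pos by simp
qed

definition survival_prob :: "nat \<Rightarrow> real" where
  "survival_prob n = 1 - (pgf p ^^ n) 0"

lemma survival_prob_0: "survival_prob 0 = 1"
  by (simp add: survival_prob_def)

lemma survival_prob_Suc_eq_pgf: "survival_prob (Suc n) = 1 - pgf p (1 - survival_prob n)"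
  by (simp add: survival_prob_def)

lemma survival_prob_bounds: "0 < survival_prob n \<and> survival_prob n \<le> 1"
proof (induction n)
  case (Suc n)
  define s where "s = 1 - survival_prob n"
  have s: "0 \<le> s" "s < 1" using Suc by (auto simp: s_def)
  have "pgf p s \<le> s + (1 - s) * pmf p 0" using s by (intro pgf_le) auto
  also have "\<dots> < s + (1 - s) * 1" using s pmf_0_less_1
    by (intro add_strict_left_mono mult_strict_left_mono) auto
  finally show ?case using s by (simp add: survival_prob_Suc_eq_pgf pgf_nonneg flip: s_def)
qed (simp add: survival_prob_0)

lemma survival_prob_pos: "0 < survival_prob n" and survival_prob_le_1: "survival_prob n \<le> 1"
  using survival_prob_bounds by auto

lemma survival_prob_Suc:
  "survival_prob (Suc n)
      = survival_prob n * (1 - survival_prob n * pgf_remainder (survival_prob n))"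
  using survival_prob_pos[of n] survival_prob_le_1[of n]
  by (simp add: survival_prob_Suc_eq_pgf pgf_one_minus algebra_simps power2_eq_square)

lemma inverse_survival_prob_diff:
  "1 / survival_prob (Suc n) - 1 / survival_prob n
    = pgf_remainder (survival_prob n) / (1 - survival_prob n * pgf_remainder (survival_prob n))"
proof -
  have "0 < 1 - survival_prob n * pgf_remainder (survival_prob n)"
    using survival_prob_pos[of "Suc n"] survival_prob_pos[of n]
    by (simp add: survival_prob_Suc zero_less_mult_iff)
  then show ?thesis
    using survival_prob_pos[of n] unfolding survival_prob_Suc by (simp add: field_simps)
qed

lemma inverse_survival_prob_diff_ge:
  "measure_pmf.prob p {2..} \<le> 1 / survival_prob (Suc n) - 1 / survival_prob n"
proof -
  define u R where "u = survival_prob n" and "R = pgf_remainder u"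
  have u: "0 < u" "u \<le> 1" unfolding u_def by (rule survival_prob_pos survival_prob_le_1)+
  have R: "measure_pmf.prob p {2..} \<le> R" unfolding R_def using u by (intro pgf_remainder_ge) auto
  then have "0 < R" using prob_ge_2_pos by linarith
  moreover have "0 < 1 - u * R"
    using survival_prob_pos[of "Suc n"] u
    by (simp add: survival_prob_Suc u_def R_def zero_less_mult_iff)
  ultimately have "R \<le> R / (1 - u * R)" using u by (simp add: pos_le_divide_eq)
  with R show ?thesis by (simp add: inverse_survival_prob_diff u_def R_def)
qed

lemma inverse_survival_prob_ge: "measure_pmf.prob p {2..} * real n \<le> 1 / survival_prob n"
proof (induction n)
  case (Suc n)
  then show ?case using inverse_survival_prob_diff_ge[of n] by (simp add: algebra_simps)
qed (simp add: survival_prob_0)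

lemma tendsto_survival_prob: "survival_prob \<longlonglongrightarrow> 0"
proof -
  have "filterlim (\<lambda>n. measure_pmf.prob p {2..} * real n) at_top sequentially"
    using prob_ge_2_pos by real_asymp
  then have "filterlim (\<lambda>n. 1 / survival_prob n) at_top sequentially"
    by (rule filterlim_at_top_mono) (simp add: inverse_survival_prob_ge)
  then have "(\<lambda>n. inverse (1 / survival_prob n)) \<longlonglongrightarrow> 0"
    by (rule tendsto_inverse_0_at_top)
  then show ?thesis by simp
qed

theorem kolmogorov_survival_asymptotics: "(\<lambda>n. real n * survival_prob n) \<longlonglongrightarrow> 2 / offspring_var"
proof -
  have "(\<lambda>n. pgf_remainder (survival_prob n)) \<longlonglongrightarrow> offspring_var / 2"
    by (intro tendsto_pgf_remainder tendsto_survival_prob survival_prob_le_1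
        less_imp_le survival_prob_pos)
  then have "(\<lambda>n. pgf_remainder (survival_prob n)
        / (1 - survival_prob n * pgf_remainder (survival_prob n)))
      \<longlonglongrightarrow> (offspring_var / 2) / (1 - 0 * (offspring_var / 2))"
    by (intro tendsto_intros tendsto_survival_prob) auto
  then have "(\<lambda>n. 1 / survival_prob (Suc n) - 1 / survival_prob n) \<longlonglongrightarrow> offspring_var / 2"
    by (simp add: inverse_survival_prob_diff)
  from tendsto_of_nat_mult_if_tendsto_inverse_diff[OF this] offspring_var_pos show ?thesis by simp
qed

end

subsection \<open>Large deviations of random walks\<close>

lemma indep_vars_PiM_coordinates:
  assumes "\<And>i. i \<in> I \<Longrightarrow> prob_space (M i)"
  shows "prob_space.indep_vars (PiM I M) M (\<lambda>i x. x i) I"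
proof -
  interpret prob_space "PiM I M" by (intro prob_space_PiM assms)
  show ?thesis
  proof (cases "I = {}")
    case True
    then show ?thesis unfolding indep_vars_def2 indep_sets_def by simp
  next
    case False
    have "distr (PiM I M) (PiM I M) (\<lambda>x. \<lambda>i\<in>I. x i) = distr (PiM I M) (PiM I M) (\<lambda>x. x)"
      by (rule distr_cong) (auto simp: space_PiM PiE_restrict)
    also have "\<dots> = PiM I (\<lambda>i. distr (PiM I M) (M i) (\<lambda>x. x i))"
      unfolding distr_id by (intro PiM_cong refl distr_PiM_component[symmetric] assms)
    finally show ?thesis
      using False
      by (subst indep_vars_iff_distr_eq_PiM') (auto intro: measurable_component_singleton)
  qed
qed

lemma exp_le_quadratic:
  fixes x :: real
  assumes "x \<le> 1"
  shows "exp x \<le> 1 + x + x\<^sup>2"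
proof (cases "0 \<le> x")
  case True
  then show ?thesis using assms by (rule exp_bound)
next
  case False
  define y where "y = - x"
  have y: "0 < y" using False by (simp add: y_def)
  have "exp x * (1 + y) \<le> exp x * exp y"
    using exp_ge_add_one_self[of y] by (intro mult_left_mono) auto
  also have "\<dots> = 1" by (simp add: y_def flip: exp_add)
  also have "1 \<le> (1 - y + y\<^sup>2) * (1 + y)"
    using y by (simp add: algebra_simps power2_eq_square)
  finally have "exp x \<le> 1 - y + y\<^sup>2" using y by (simp add: mult_le_cancel_right)
  then show ?thesis by (simp add: y_def)
qed

context prob_space
begin

lemma integrable_exp_min:
  fixes X :: "'a \<Rightarrow> real"
  assumes [measurable]: "X \<in> borel_measurable M" and b: "0 < b"
  shows "integrable M (\<lambda>\<omega>. exp (min (X \<omega>) b / b))"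
  using b by (intro integrable_const_bound[where B = "exp 1"]) (auto simp: min_def divide_le_eq)

text \<open>Truncating only from above keeps the mean nonpositive, so no centring is needed.\<close>

lemma expectation_exp_min_le:
  fixes X :: "'a \<Rightarrow> real"
  assumes X: "integrable M X" "expectation X \<le> 0" "integrable M (\<lambda>\<omega>. (X \<omega>)\<^sup>2)" and b: "0 < b"
  shows "expectation (\<lambda>\<omega>. exp (min (X \<omega>) b / b)) \<le> exp (expectation (\<lambda>\<omega>. (X \<omega>)\<^sup>2) / b\<^sup>2)"
proof -
  have [measurable]: "X \<in> borel_measurable M" using X(1) by auto
  have int_min: "integrable M (\<lambda>\<omega>. min (X \<omega>) b)" using X(1) by (intro integrable_min) auto
  have sq_le: "(min (X \<omega>) b)\<^sup>2 \<le> (X \<omega>)\<^sup>2" for \<omega>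
    using b by (auto simp: min_def intro!: power_mono)
  have int_min_sq: "integrable M (\<lambda>\<omega>. (min (X \<omega>) b)\<^sup>2)"
    by (rule Bochner_Integration.integrable_bound[OF X(3)]) (use sq_le in auto)
  have "exp (min (X \<omega>) b / b) \<le> 1 + min (X \<omega>) b / b + (min (X \<omega>) b)\<^sup>2 / b\<^sup>2" for \<omega>
    using b by (intro order_trans[OF exp_le_quadratic]) (auto simp: divide_le_eq power_divide)
  then have "expectation (\<lambda>\<omega>. exp (min (X \<omega>) b / b))
      \<le> expectation (\<lambda>\<omega>. 1 + min (X \<omega>) b / b + (min (X \<omega>) b)\<^sup>2 / b\<^sup>2)"
    using int_min int_min_sq b by (intro integral_mono integrable_exp_min) auto
  also have "\<dots> = 1 + expectation (\<lambda>\<omega>. min (X \<omega>) b) / b + expectation (\<lambda>\<omega>. (min (X \<omega>) b)\<^sup>2) / b\<^sup>2"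
    using int_min int_min_sq by (simp add: prob_space)
  also have "\<dots> \<le> 1 + 0 + expectation (\<lambda>\<omega>. (X \<omega>)\<^sup>2) / b\<^sup>2"
  proof -
    have "expectation (\<lambda>\<omega>. min (X \<omega>) b) \<le> expectation X"
      using int_min X by (intro integral_mono) auto
    moreover have "expectation (\<lambda>\<omega>. (min (X \<omega>) b)\<^sup>2) \<le> expectation (\<lambda>\<omega>. (X \<omega>)\<^sup>2)"
      using int_min_sq X sq_le by (intro integral_mono) auto
    ultimately show ?thesis
      using b X(2) by (intro add_mono divide_right_mono) (auto simp: divide_le_0_iff)
  qed
  also have "\<dots> \<le> exp (expectation (\<lambda>\<omega>. (X \<omega>)\<^sup>2) / b\<^sup>2)"
    using exp_ge_add_one_self[of "expectation (\<lambda>\<omega>. (X \<omega>)\<^sup>2) / b\<^sup>2"] by simp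
  finally show ?thesis .
qed

lemma prob_sum_min_gt_le:
  fixes X :: "'i \<Rightarrow> 'a \<Rightarrow> real"
  assumes I: "finite I" and indep: "indep_vars (\<lambda>_. borel) X I"
    and X: "\<And>i. i \<in> I \<Longrightarrow> integrable M (X i)" "\<And>i. i \<in> I \<Longrightarrow> expectation (X i) \<le> 0"
      "\<And>i. i \<in> I \<Longrightarrow> integrable M (\<lambda>\<omega>. (X i \<omega>)\<^sup>2)"
    and b: "0 < b"
  shows "\<P>(\<omega> in M. (\<Sum>i\<in>I. min (X i \<omega>) b) > t)
    \<le> exp ((\<Sum>i\<in>I. expectation (\<lambda>\<omega>. (X i \<omega>)\<^sup>2)) / b\<^sup>2 - t / b)"
proof -
  have [measurable]: "X i \<in> borel_measurable M" if "i \<in> I" for i using X(1)[OF that] by auto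
  have indep_exp: "indep_vars (\<lambda>_. borel) (\<lambda>i \<omega>. exp (min (X i \<omega>) b / b)) I"
    by (rule indep_vars_compose2[OF indep]) measurable
  have exp_sum_min: "exp ((\<Sum>i\<in>I. min (X i \<omega>) b) / b) = (\<Prod>i\<in>I. exp (min (X i \<omega>) b / b))" for \<omega>
    using I by (simp add: sum_divide_distrib exp_sum)
  have int: "integrable M (\<lambda>\<omega>. exp ((\<Sum>i\<in>I. min (X i \<omega>) b) / b))"
    unfolding exp_sum_min using b
    by (intro indep_vars_integrable[OF I indep_exp] integrable_exp_min) auto
  have "\<P>(\<omega> in M. (\<Sum>i\<in>I. min (X i \<omega>) b) > t)
      \<le> \<P>(\<omega> in M. exp ((\<Sum>i\<in>I. min (X i \<omega>) b) / b) \<ge> exp (t / b))"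
    using b by (intro finite_measure_mono) (auto intro: divide_right_mono)
  also have "\<dots> \<le> expectation (\<lambda>\<omega>. exp ((\<Sum>i\<in>I. min (X i \<omega>) b) / b)) / exp (t / b)"
    by (rule integral_Markov_inequality_measure[OF int, of "space M"]) auto
  also have "expectation (\<lambda>\<omega>. exp ((\<Sum>i\<in>I. min (X i \<omega>) b) / b))
      = (\<Prod>i\<in>I. expectation (\<lambda>\<omega>. exp (min (X i \<omega>) b / b)))"
    unfolding exp_sum_min using b
    by (intro indep_vars_lebesgue_integral[OF I indep_exp] integrable_exp_min) auto
  also have "\<dots> \<le> (\<Prod>i\<in>I. exp (expectation (\<lambda>\<omega>. (X i \<omega>)\<^sup>2) / b\<^sup>2))"
    using X b by (intro prod_mono) (auto intro!: expectation_exp_min_le)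
  also have "\<dots> = exp ((\<Sum>i\<in>I. expectation (\<lambda>\<omega>. (X i \<omega>)\<^sup>2)) / b\<^sup>2)"
    using I by (simp add: sum_divide_distrib exp_sum)
  finally show ?thesis by (simp add: exp_diff divide_right_mono)
qed

lemma fuk_nagaev_gt:
  fixes X :: "'i \<Rightarrow> 'a \<Rightarrow> real"
  assumes I: "finite I" and indep: "indep_vars (\<lambda>_. borel) X I"
    and X: "\<And>i. i \<in> I \<Longrightarrow> integrable M (X i)" "\<And>i. i \<in> I \<Longrightarrow> expectation (X i) \<le> 0"
      "\<And>i. i \<in> I \<Longrightarrow> integrable M (\<lambda>\<omega>. (X i \<omega>)\<^sup>2)"
    and b: "0 < b"
  shows "\<P>(\<omega> in M. (\<Sum>i\<in>I. X i \<omega>) > t) \<le> (\<Sum>i\<in>I. \<P>(\<omega> in M. X i \<omega> > b))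
    + exp ((\<Sum>i\<in>I. expectation (\<lambda>\<omega>. (X i \<omega>)\<^sup>2)) / b\<^sup>2 - t / b)"
proof -
  have [measurable]: "X i \<in> borel_measurable M" if "i \<in> I" for i using X(1)[OF that] by auto
  have "{\<omega> \<in> space M. (\<Sum>i\<in>I. X i \<omega>) > t}
      \<subseteq> (\<Union>i\<in>I. {\<omega> \<in> space M. X i \<omega> > b}) \<union> {\<omega> \<in> space M. (\<Sum>i\<in>I. min (X i \<omega>) b) > t}"
  proof
    fix \<omega> assume \<omega>: "\<omega> \<in> {\<omega> \<in> space M. (\<Sum>i\<in>I. X i \<omega>) > t}"
    show "\<omega> \<in> (\<Union>i\<in>I. {\<omega> \<in> space M. X i \<omega> > b}) \<union> {\<omega> \<in> space M. (\<Sum>i\<in>I. min (X i \<omega>) b) > t}"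
    proof (cases "\<exists>i\<in>I. X i \<omega> > b")
      case False
      then have "(\<Sum>i\<in>I. min (X i \<omega>) b) = (\<Sum>i\<in>I. X i \<omega>)"
        by (intro sum.cong refl) (auto simp: min_def not_less)
      with \<omega> show ?thesis by simp
    qed (use \<omega> in auto)
  qed
  then have "\<P>(\<omega> in M. (\<Sum>i\<in>I. X i \<omega>) > t)
      \<le> prob ((\<Union>i\<in>I. {\<omega> \<in> space M. X i \<omega> > b}) \<union> {\<omega> \<in> space M. (\<Sum>i\<in>I. min (X i \<omega>) b) > t})"
    using I by (intro finite_measure_mono sets.Un sets.finite_UN) measurable
  also have "\<dots> \<le> prob (\<Union>i\<in>I. {\<omega> \<in> space M. X i \<omega> > b}) + \<P>(\<omega> in M. (\<Sum>i\<in>I. min (X i \<omega>) b) > t)"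
    using I by (intro measure_Un_le sets.finite_UN) measurable
  also have "\<dots>
      \<le> (\<Sum>i\<in>I. \<P>(\<omega> in M. X i \<omega> > b)) + exp ((\<Sum>i\<in>I. expectation (\<lambda>\<omega>. (X i \<omega>)\<^sup>2)) / b\<^sup>2 - t / b)"
    using I indep X b by (intro add_mono measure_UNION_le prob_sum_min_gt_le) measurable
  finally show ?thesis .
qed

lemma fuk_nagaev_abs_gt:
  fixes X :: "'i \<Rightarrow> 'a \<Rightarrow> real"
  assumes I: "finite I" and indep: "indep_vars (\<lambda>_. borel) X I"
    and X: "\<And>i. i \<in> I \<Longrightarrow> integrable M (X i)" "\<And>i. i \<in> I \<Longrightarrow> expectation (X i) = 0"
      "\<And>i. i \<in> I \<Longrightarrow> integrable M (\<lambda>\<omega>. (X i \<omega>)\<^sup>2)"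
    and b: "0 < b"
  shows "\<P>(\<omega> in M. \<bar>\<Sum>i\<in>I. X i \<omega>\<bar> > t) \<le> (\<Sum>i\<in>I. \<P>(\<omega> in M. \<bar>X i \<omega>\<bar> > b))
    + 2 * exp ((\<Sum>i\<in>I. expectation (\<lambda>\<omega>. (X i \<omega>)\<^sup>2)) / b\<^sup>2 - t / b)"
proof -
  have X_meas [measurable]: "X i \<in> borel_measurable M" if "i \<in> I" for i using X(1)[OF that] by auto
  have "indep_vars (\<lambda>_. borel) (\<lambda>i \<omega>. - X i \<omega>) I"
    by (rule indep_vars_compose2[OF indep]) measurable
  from fuk_nagaev_gt[OF I this _ _ _ b] X
  have lower: "\<P>(\<omega> in M. - (\<Sum>i\<in>I. X i \<omega>) > t) \<le> (\<Sum>i\<in>I. \<P>(\<omega> in M. - X i \<omega> > b))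
      + exp ((\<Sum>i\<in>I. expectation (\<lambda>\<omega>. (X i \<omega>)\<^sup>2)) / b\<^sup>2 - t / b)"
    by (simp flip: sum_negf)
  have upper: "\<P>(\<omega> in M. (\<Sum>i\<in>I. X i \<omega>) > t) \<le> (\<Sum>i\<in>I. \<P>(\<omega> in M. X i \<omega> > b))
      + exp ((\<Sum>i\<in>I. expectation (\<lambda>\<omega>. (X i \<omega>)\<^sup>2)) / b\<^sup>2 - t / b)"
    using X by (intro fuk_nagaev_gt I indep b) auto
  have "\<P>(\<omega> in M. \<bar>X i \<omega>\<bar> > b) = \<P>(\<omega> in M. X i \<omega> > b) + \<P>(\<omega> in M. - X i \<omega> > b)" if "i \<in> I" for i
    using b X_meas[OF that]
    by (subst finite_measure_Union[symmetric]) (auto intro!: arg_cong[where f = prob])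
  then have "(\<Sum>i\<in>I. \<P>(\<omega> in M. \<bar>X i \<omega>\<bar> > b))
      = (\<Sum>i\<in>I. \<P>(\<omega> in M. X i \<omega> > b)) + (\<Sum>i\<in>I. \<P>(\<omega> in M. - X i \<omega> > b))"
    by (simp add: sum.distrib)
  moreover have "\<P>(\<omega> in M. \<bar>\<Sum>i\<in>I. X i \<omega>\<bar> > t)
      \<le> prob ({\<omega> \<in> space M. (\<Sum>i\<in>I. X i \<omega>) > t} \<union> {\<omega> \<in> space M. - (\<Sum>i\<in>I. X i \<omega>) > t})"
    by (intro finite_measure_mono) auto
  moreover have "\<dots> \<le> \<P>(\<omega> in M. (\<Sum>i\<in>I. X i \<omega>) > t) + \<P>(\<omega> in M. - (\<Sum>i\<in>I. X i \<omega>) > t)"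
    by (intro measure_Un_le) measurable
  ultimately show ?thesis using lower upper by linarith
qed

lemma fuk_nagaev_iid_abs_gt:
  fixes X :: "'i \<Rightarrow> 'a \<Rightarrow> real"
  assumes I: "finite I" and indep: "indep_vars (\<lambda>_. borel) X I"
    and distr: "\<And>i. i \<in> I \<Longrightarrow> distr M borel (X i) = \<mu>"
    and \<mu>: "integrable \<mu> (\<lambda>x. x)" "(\<integral>x. x \<partial>\<mu>) = 0" "integrable \<mu> (\<lambda>x. x\<^sup>2)" and b: "0 < b"
  shows "\<P>(\<omega> in M. \<bar>\<Sum>i\<in>I. X i \<omega>\<bar> > t)
    \<le> real (card I) * measure \<mu> {x. \<bar>x\<bar> > b} + 2 * exp (real (card I) * (\<integral>x. x\<^sup>2 \<partial>\<mu>) / b\<^sup>2 - t / b)"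
proof -
  have X_meas: "X i \<in> borel_measurable M" if "i \<in> I" for i
    using indep that by (auto simp: indep_vars_def)
  have "integrable M (X i)" "expectation (X i) = 0" "integrable M (\<lambda>\<omega>. (X i \<omega>)\<^sup>2)" if "i \<in> I" for i
    using \<mu> X_meas[OF that] unfolding distr[OF that, symmetric]
    by (simp_all add: integrable_distr_eq integral_distr)
  then have "\<P>(\<omega> in M. \<bar>\<Sum>i\<in>I. X i \<omega>\<bar> > t) \<le> (\<Sum>i\<in>I. \<P>(\<omega> in M. \<bar>X i \<omega>\<bar> > b))
      + 2 * exp ((\<Sum>i\<in>I. expectation (\<lambda>\<omega>. (X i \<omega>)\<^sup>2)) / b\<^sup>2 - t / b)"
    by (intro fuk_nagaev_abs_gt I indep b)
  moreover have "\<P>(\<omega> in M. \<bar>X i \<omega>\<bar> > b) = measure \<mu> {x. \<bar>x\<bar> > b}"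
    "expectation (\<lambda>\<omega>. (X i \<omega>)\<^sup>2) = (\<integral>x. x\<^sup>2 \<partial>\<mu>)" if "i \<in> I" for i
    using X_meas[OF that] unfolding distr[OF that, symmetric]
    by (simp_all add: measure_distr integral_distr vimage_def Int_def conj_commute)
  ultimately show ?thesis by simp
qed

lemma prob_abs_gt_le_powr_moment:
  fixes X :: "'a \<Rightarrow> real"
  assumes "integrable M (\<lambda>\<omega>. \<bar>X \<omega>\<bar> powr \<alpha>)" "X \<in> borel_measurable M" "0 < b" "0 \<le> \<alpha>"
  shows "\<P>(\<omega> in M. \<bar>X \<omega>\<bar> > b) \<le> expectation (\<lambda>\<omega>. \<bar>X \<omega>\<bar> powr \<alpha>) / b powr \<alpha>"
proof -
  note [measurable] = assms(2)
  have "\<P>(\<omega> in M. \<bar>X \<omega>\<bar> > b) \<le> \<P>(\<omega> in M. \<bar>X \<omega>\<bar> powr \<alpha> \<ge> b powr \<alpha>)"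
    using assms by (intro finite_measure_mono) (auto intro!: powr_mono2)
  also have "\<dots> \<le> expectation (\<lambda>\<omega>. \<bar>X \<omega>\<bar> powr \<alpha>) / b powr \<alpha>"
    using assms by (intro integral_Markov_inequality_measure[where A = "space M"]) auto
  finally show ?thesis .
qed

lemma integrable_power2_if_integrable_powr:
  fixes X :: "'a \<Rightarrow> real"
  assumes "integrable M (\<lambda>\<omega>. \<bar>X \<omega>\<bar> powr \<alpha>)" "X \<in> borel_measurable M" "2 \<le> \<alpha>"
  shows "integrable M (\<lambda>\<omega>. (X \<omega>)\<^sup>2)"
proof (rule Bochner_Integration.integrable_bound)
  show "integrable M (\<lambda>\<omega>. 1 + \<bar>X \<omega>\<bar> powr \<alpha>)" using assms by auto
  have "x\<^sup>2 \<le> 1 + \<bar>x\<bar> powr \<alpha>" for x :: real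
  proof (cases "1 \<le> \<bar>x\<bar>")
    case True
    then have "\<bar>x\<bar> powr 2 \<le> \<bar>x\<bar> powr \<alpha>" using assms by (intro powr_mono) auto
    then show ?thesis using True by simp
  next
    case False
    then have "\<bar>x\<bar>\<^sup>2 \<le> 1" by (intro power_le_one) auto
    then show ?thesis by (simp add: add_increasing2)
  qed
  then show "AE \<omega> in M. norm ((X \<omega>)\<^sup>2) \<le> norm (1 + \<bar>X \<omega>\<bar> powr \<alpha>)"
    by (auto intro: order_trans[OF _ abs_ge_self])
qed (use assms in auto)

end

text \<open>With truncation level \<open>n powr \<beta>\<close>, the condition \<open>\<beta> < 1\<close> makes the Chernoff term negligible,
  and \<open>\<beta> \<alpha> > 2\<close> makes a single large step improbable.\<close>

lemma tendsto_fuk_nagaev_bound: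
  fixes \<alpha> \<beta> \<epsilon> C V :: real
  assumes \<beta>: "1 / 2 < \<beta>" "\<beta> < 1" "2 < \<beta> * \<alpha>" and \<epsilon>: "0 < \<epsilon>"
  shows "(\<lambda>n. real n * (real n * (C / (real n powr \<beta>) powr \<alpha>)
      + 2 * exp (real n * V / (real n powr \<beta>)\<^sup>2 - \<epsilon> * real n / real n powr \<beta>))) \<longlonglongrightarrow> 0"
proof -
  have "(\<lambda>n. real n * real n / (real n powr \<beta>) powr \<alpha>) \<longlonglongrightarrow> 0"
    unfolding powr_powr using \<beta>(3) by real_asymp
  moreover have "(\<lambda>n. real n / (real n powr \<beta>)\<^sup>2) \<longlonglongrightarrow> 0" using \<beta>(1) by real_asymp
  moreover have "(\<lambda>n. real n * exp (- \<epsilon> * real n / real n powr \<beta>)) \<longlonglongrightarrow> 0" using \<beta>(2) \<epsilon> by real_asymp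
  ultimately have "(\<lambda>n. C * (real n * real n / (real n powr \<beta>) powr \<alpha>)
      + 2 * exp (V * (real n / (real n powr \<beta>)\<^sup>2)) * (real n * exp (- \<epsilon> * real n / real n powr \<beta>)))
      \<longlonglongrightarrow> C * 0 + 2 * exp (V * 0) * 0"
    by (intro tendsto_intros)
  then show ?thesis by (simp add: exp_diff exp_minus divide_inverse algebra_simps)
qed

definition random_walk_law :: "real measure \<Rightarrow> nat \<Rightarrow> real measure" where
  "random_walk_law \<mu> n = distr (PiM {..<n} (\<lambda>_. \<mu>)) borel (\<lambda>x. \<Sum>j<n. x j)"

context real_distribution
begin

lemma prob_space_random_walk_law: "prob_space (random_walk_law M n)"
proof -
  interpret walk: prob_space "PiM {..<n} (\<lambda>_. M)" by (intro prob_space_PiM prob_space_axioms)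
  show ?thesis unfolding random_walk_law_def by (rule walk.prob_space_distr) measurable
qed

lemma random_walk_tail_le:
  assumes X: "integrable M (\<lambda>x. x)" "expectation (\<lambda>x. x) = 0" "integrable M (\<lambda>x. x\<^sup>2)"
    and b: "0 < b"
  shows "measure (random_walk_law M n) {s. \<bar>s\<bar> > t}
    \<le> real n * prob {x. \<bar>x\<bar> > b} + 2 * exp (real n * expectation (\<lambda>x. x\<^sup>2) / b\<^sup>2 - t / b)"
proof -
  define P where "P = PiM {..<n} (\<lambda>_. M)"
  interpret P: prob_space P unfolding P_def by (intro prob_space_PiM prob_space_axioms)
  have "P.indep_vars (\<lambda>_. M) (\<lambda>i x. x i) {..<n}"
    unfolding P_def by (intro indep_vars_PiM_coordinates prob_space_axioms)
  then have indep: "P.indep_vars (\<lambda>_. borel) (\<lambda>i x. x i) {..<n}"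
    by (rule P.indep_vars_compose2) auto
  have distr_coordinate: "distr P borel (\<lambda>x. x i) = M" if "i < n" for i
  proof -
    have "distr P borel (\<lambda>x. x i) = distr P M (\<lambda>x. x i)" by (rule distr_cong) auto
    also have "\<dots> = M" using that unfolding P_def
      by (intro distr_PiM_component prob_space_axioms) auto
    finally show ?thesis .
  qed
  have [measurable]: "(\<lambda>x. \<Sum>j<n. x j) \<in> borel_measurable P"
    using indep by (intro borel_measurable_sum) (auto simp: P.indep_vars_def)
  have "measure (random_walk_law M n) {s. \<bar>s\<bar> > t} = \<P>(x in P. \<bar>\<Sum>j<n. x j\<bar> > t)"
    unfolding random_walk_law_def P_def[symmetric]
    by (subst measure_distr) (auto simp: vimage_def Int_def conj_commute)
  also have "\<dots> \<le> real (card {..<n}) * prob {x. \<bar>x\<bar> > b}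
      + 2 * exp (real (card {..<n}) * expectation (\<lambda>x. x\<^sup>2) / b\<^sup>2 - t / b)"
    by (rule P.fuk_nagaev_iid_abs_gt[OF _ indep distr_coordinate X b]) auto
  finally show ?thesis by simp
qed

theorem tendsto_random_walk_tail:
  assumes X: "integrable M (\<lambda>x. x)" "expectation (\<lambda>x. x) = 0"
    and \<alpha>: "2 < \<alpha>" "integrable M (\<lambda>x. \<bar>x\<bar> powr \<alpha>)" and \<epsilon>: "0 < \<epsilon>"
  shows "(\<lambda>n. real n * measure (random_walk_law M n) {s. \<bar>s\<bar> > \<epsilon> * real n}) \<longlonglongrightarrow> 0"
proof (rule tendsto_sandwich[where f = "\<lambda>_. 0"])
  define C V where "C = expectation (\<lambda>x. \<bar>x\<bar> powr \<alpha>)" and "V = expectation (\<lambda>x. x\<^sup>2)"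
  define \<beta> where "\<beta> = 1 / 2 + 1 / \<alpha>"
  have \<beta>: "1 / 2 < \<beta>" "\<beta> < 1" "2 < \<beta> * \<alpha>" using \<alpha> by (auto simp: \<beta>_def field_simps)
  define bound where "bound n = real n * (C / (real n powr \<beta>) powr \<alpha>)
      + 2 * exp (real n * V / (real n powr \<beta>)\<^sup>2 - \<epsilon> * real n / real n powr \<beta>)" for n
  show "(\<lambda>n. real n * bound n) \<longlonglongrightarrow> 0"
    unfolding bound_def using \<beta> \<epsilon> by (rule tendsto_fuk_nagaev_bound)
  have sq: "integrable M (\<lambda>x. x\<^sup>2)"
    using \<alpha> by (intro integrable_power2_if_integrable_powr[of "\<lambda>x. x" \<alpha>]) auto
  show "\<forall>\<^sub>F n in sequentially. real n * measure (random_walk_law M n) {s. \<bar>s\<bar> > \<epsilon> * real n}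
      \<le> real n * bound n"
    using eventually_gt_at_top[of 0]
  proof eventually_elim
    case (elim n)
    then have b: "0 < real n powr \<beta>" by simp
    have "measure (random_walk_law M n) {s. \<bar>s\<bar> > \<epsilon> * real n}
        \<le> real n * prob {x. \<bar>x\<bar> > real n powr \<beta>}
        + 2 * exp (real n * V / (real n powr \<beta>)\<^sup>2 - \<epsilon> * real n / real n powr \<beta>)"
      unfolding V_def by (rule random_walk_tail_le[OF X sq b])
    also have "\<dots> \<le> bound n"
      unfolding bound_def C_def using \<alpha> b prob_abs_gt_le_powr_moment[of "\<lambda>x. x" \<alpha>]
      by (intro add_right_mono mult_left_mono) auto
    finally show ?case by (rule mult_left_mono) simp
  qed
qed auto

end

subsection \<open>Random index sets\<close>

lemma emeasure_UN_countable_le: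
  assumes sets: "\<And>i. i \<in> I \<Longrightarrow> X i \<in> sets M" and I: "countable I"
  shows "emeasure M (\<Union>i\<in>I. X i) \<le> (\<integral>\<^sup>+i. emeasure M (X i) \<partial>count_space I)"
proof -
  have "indicator (\<Union>i\<in>I. X i) x \<le> (\<integral>\<^sup>+i. indicator (X i) x \<partial>count_space I :: ennreal)" for x
  proof (cases "\<exists>i\<in>I. x \<in> X i")
    case True
    then obtain i where "i \<in> I" "x \<in> X i" by blast
    then show ?thesis
      using nn_integral_ge_point[of i I "\<lambda>i. indicator (X i) x"] by (auto simp: indicator_def)
  qed simp
  then have "(\<integral>\<^sup>+x. indicator (\<Union>i\<in>I. X i) x \<partial>M) \<le> (\<integral>\<^sup>+x. \<integral>\<^sup>+i. indicator (X i) x \<partial>count_space I \<partial>M)"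
    by (rule nn_integral_mono)
  also have "\<dots> = (\<integral>\<^sup>+i. \<integral>\<^sup>+x. indicator (X i) x \<partial>M \<partial>count_space I)"
    using sets I by (intro nn_integral_count_space_nn_integral) auto
  also have "\<dots> = (\<integral>\<^sup>+i. emeasure M (X i) \<partial>count_space I)"
    using sets by (intro nn_integral_cong) auto
  finally show ?thesis
    using sets I by (simp add: sets.countable_UN'')
qed

lemma nn_integral_countable_image:
  assumes S: "countable S" and J: "AE \<omega> in M. J \<omega> \<in> S" "\<And>I. I \<in> S \<Longrightarrow> {\<omega> \<in> space M. J \<omega> = I} \<in> sets M"
  shows "(\<integral>\<^sup>+\<omega>. f (J \<omega>) \<partial>M) = (\<integral>\<^sup>+I. f I * emeasure M {\<omega> \<in> space M. J \<omega> = I} \<partial>count_space S)"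
proof -
  have "(\<integral>\<^sup>+\<omega>. f (J \<omega>) \<partial>M)
      = (\<integral>\<^sup>+\<omega>. \<integral>\<^sup>+I. f I * indicator {\<omega> \<in> space M. J \<omega> = I} \<omega> \<partial>count_space S \<partial>M)"
  proof (rule nn_integral_cong_AE)
    from J(1) AE_space
    show "AE \<omega> in M. f (J \<omega>) = (\<integral>\<^sup>+I. f I * indicator {\<omega> \<in> space M. J \<omega> = I} \<omega> \<partial>count_space S)"
    proof eventually_elim
      case (elim \<omega>)
      then show ?case by (subst nn_integral_count_space'[where A = "{J \<omega>}"]) auto
    qed
  qed
  also have "\<dots> = (\<integral>\<^sup>+I. \<integral>\<^sup>+\<omega>. f I * indicator {\<omega> \<in> space M. J \<omega> = I} \<omega> \<partial>M \<partial>count_space S)"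
    using S J(2) by (intro nn_integral_count_space_nn_integral) auto
  also have "\<dots> = (\<integral>\<^sup>+I. f I * emeasure M {\<omega> \<in> space M. J \<omega> = I} \<partial>count_space S)"
    using J(2) by (intro nn_integral_cong nn_integral_cmult_indicator) auto
  finally show ?thesis .
qed

lemma (in prob_space) emeasure_all_in_random_index_set:
  fixes J :: "'a \<Rightarrow> 'i :: countable set"
  assumes J: "\<And>i. {\<omega> \<in> space M. i \<in> J \<omega>} \<in> events" "AE \<omega> in M. finite (J \<omega>)"
    and F: "\<And>i. {\<omega> \<in> space M. F i \<omega>} \<in> events"
    and indep: "\<And>I. finite I \<Longrightarrow>
      \<P>(\<omega> in M. J \<omega> = I \<and> (\<forall>i\<in>I. F i \<omega>)) = \<P>(\<omega> in M. J \<omega> = I) * q ^ card I"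
    and q: "0 \<le> q"
  shows "emeasure M {\<omega> \<in> space M. \<forall>i\<in>J \<omega>. F i \<omega>} = (\<integral>\<^sup>+\<omega>. ennreal (q ^ card (J \<omega>)) \<partial>M)"
proof -
  have [measurable]: "Measurable.pred M (\<lambda>\<omega>. i \<in> J \<omega>)" "Measurable.pred M (F i)" for i
    using J(1) F by (auto simp: pred_def)
  define E where "E I = {\<omega> \<in> space M. J \<omega> = I}" for I
  define G where "G I = {\<omega> \<in> space M. J \<omega> = I \<and> (\<forall>i\<in>I. F i \<omega>)}" for I
  have E_sets [measurable]: "E I \<in> events" for I unfolding E_def set_eq_iff by measurable
  have G_sets: "G I \<in> events" for I unfolding G_def set_eq_iff by measurable
  have countable_finite: "countable (Collect finite :: 'i set set)"
    by (rule countable_Collect_finite)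
  have "emeasure M {\<omega> \<in> space M. \<forall>i\<in>J \<omega>. F i \<omega>} = emeasure M (\<Union>I\<in>Collect finite. G I)"
  proof (rule emeasure_eq_AE)
    from J(2) show "AE \<omega> in M. \<omega> \<in> {\<omega> \<in> space M. \<forall>i\<in>J \<omega>. F i \<omega>} \<longleftrightarrow> \<omega> \<in> (\<Union>I\<in>Collect finite. G I)"
      by eventually_elim (auto simp: G_def)
    have "{\<omega> \<in> space M. \<forall>i. i \<in> J \<omega> \<longrightarrow> F i \<omega>} \<in> events" by measurable
    then show "{\<omega> \<in> space M. \<forall>i\<in>J \<omega>. F i \<omega>} \<in> events" by (simp add: Ball_def)
    show "(\<Union>I\<in>Collect finite. G I) \<in> events"
      by (intro sets.countable_UN'' countable_finite G_sets)
  qed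
  also have "\<dots> = (\<integral>\<^sup>+I. emeasure M (G I) \<partial>count_space (Collect finite))"
    by (intro emeasure_UN_countable countable_finite G_sets)
      (auto simp: disjoint_family_on_def G_def)
  also have "\<dots> = (\<integral>\<^sup>+I. ennreal (q ^ card I) * emeasure M (E I) \<partial>count_space (Collect finite))"
    using indep q
    by (intro nn_integral_cong) (simp add: G_def E_def emeasure_eq_measure ennreal_mult mult.commute)
  also have "\<dots> = (\<integral>\<^sup>+\<omega>. ennreal (q ^ card (J \<omega>)) \<partial>M)"
    using J(2) E_sets unfolding E_def
    by (intro nn_integral_countable_image[symmetric] countable_finite) auto
  finally show ?thesis .
qed

subsection \<open>The law of a single tree\<close>

text \<open>A tree is a marking of the Ulam--Harris labels by pairs (number of children, displacement).\<close>

definition tree_gen :: "nat \<Rightarrow> (nat list \<Rightarrow> nat \<times> real) \<Rightarrow> nat list set" where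
  "tree_gen n x = {v. length v = n \<and> (\<forall>j<n. v ! j < fst (x (take j v)))}"

definition tree_disp :: "nat list \<Rightarrow> (nat list \<Rightarrow> nat \<times> real) \<Rightarrow> real" where
  "tree_disp v x = (\<Sum>j<length v. snd (x (take (Suc j) v)))"

definition subtree :: "nat \<Rightarrow> (nat list \<Rightarrow> 'b) \<Rightarrow> nat list \<Rightarrow> 'b" where
  "subtree j x = (\<lambda>w. x (j # w))"

abbreviation mark_space :: "(nat \<times> real) measure" where
  "mark_space \<equiv> count_space UNIV \<Otimes>\<^sub>M borel"

abbreviation tree_space :: "(nat list \<Rightarrow> nat \<times> real) measure" where
  "tree_space \<equiv> PiM UNIV (\<lambda>_. mark_space)"

lemma tree_gen_0: "tree_gen 0 x = {[]}"
  by (auto simp: tree_gen_def)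

lemma Cons_in_tree_gen_Suc:
  "j # v \<in> tree_gen (Suc n) x \<longleftrightarrow> j < fst (x []) \<and> v \<in> tree_gen n (subtree j x)"
  by (auto simp: tree_gen_def subtree_def less_Suc_eq_0_disj)

lemma tree_gen_Suc_empty_iff:
  "tree_gen (Suc n) x = {} \<longleftrightarrow> (\<forall>j<fst (x []). tree_gen n (subtree j x) = {})"
proof -
  have "v \<in> tree_gen (Suc n) x \<Longrightarrow> \<exists>j w. v = j # w" for v
    by (cases v) (auto simp: tree_gen_def)
  then show ?thesis by (metis Cons_in_tree_gen_Suc equals0I ex_in_conv)
qed

lemma measurable_in_tree_gen [measurable]:
  "Measurable.pred tree_space (\<lambda>x. v \<in> tree_gen n x)"
  unfolding tree_gen_def by measurable

lemma measurable_tree_gen_empty [measurable]: "Measurable.pred tree_space (\<lambda>x. tree_gen n x = {})"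
  unfolding set_eq_iff empty_iff by measurable

lemma measurable_tree_disp [measurable]: "tree_disp v \<in> borel_measurable tree_space"
  unfolding tree_disp_def[abs_def] by measurable

lemma measurable_subtree:
  assumes "range (Cons j) \<subseteq> W"
  shows "subtree j \<in> PiM W (\<lambda>_. N) \<rightarrow>\<^sub>M PiM UNIV (\<lambda>_. N)"
  unfolding subtree_def[abs_def] using assms
  by (intro measurable_PiM_single')
    (auto intro!: measurable_component_singleton simp: space_PiM PiE_iff)

lemma nn_integral_prod_lists:
  fixes a :: "nat \<Rightarrow> ennreal"
  shows "(\<integral>\<^sup>+v. (\<Prod>j<n. a (v ! j)) \<partial>count_space {v. length v = n}) = (\<Sum>k. a k) ^ n"
proof (induction n)
  case 0
  have "{v :: nat list. length v = 0} = {[]}" by auto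
  then show ?case by (simp add: nn_integral_count_space_finite)
next
  case (Suc n)
  interpret lists: sigma_finite_measure "count_space {v :: nat list. length v = n}"
    by (rule sigma_finite_measure_count_space_countable) simp
  have pair_eq: "count_space (UNIV \<times> {v. length v = n})
      = count_space (UNIV :: nat set) \<Otimes>\<^sub>M count_space {v :: nat list. length v = n}"
    by (rule pair_measure_countable[symmetric]) auto
  have bij: "bij_betw (\<lambda>(k, v). k # v) (UNIV \<times> {v. length v = n}) {v :: nat list. length v = Suc n}"
    by (rule bij_betwI[where g = "\<lambda>v. (hd v, tl v)"]) (auto simp: length_Suc_conv)
  have "(\<integral>\<^sup>+v. (\<Prod>j<Suc n. a (v ! j)) \<partial>count_space {v. length v = Suc n})
      = (\<integral>\<^sup>+(k, v). a k * (\<Prod>j<n. a (v ! j)) \<partial>count_space (UNIV \<times> {v. length v = n}))"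
    by (subst nn_integral_bij_count_space[OF bij, symmetric])
      (auto simp: prod.lessThan_Suc_shift intro!: nn_integral_cong simp del: prod.lessThan_Suc)
  also have "\<dots>
      = (\<integral>\<^sup>+k. \<integral>\<^sup>+v. a k * (\<Prod>j<n. a (v ! j)) \<partial>count_space {v. length v = n} \<partial>count_space UNIV)"
    unfolding pair_eq by (subst lists.nn_integral_fst[symmetric]) (simp_all flip: pair_eq)
  also have "\<dots> = (\<Sum>k. a k) ^ Suc n"
    by (simp add: nn_integral_cmult nn_integral_multc Suc nn_integral_count_space_nat)
  finally show ?case .
qed

locale branching_random_walk = step: real_distribution \<mu>
  for p :: "nat pmf" and \<mu> :: "real measure"
begin

definition mark_law :: "(nat \<times> real) measure" where
  "mark_law = measure_pmf p \<Otimes>\<^sub>M \<mu>"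

definition tree_law :: "(nat list \<Rightarrow> nat \<times> real) measure" where
  "tree_law = PiM UNIV (\<lambda>_. mark_law)"

lemma sets_mark_law [measurable_cong]: "sets mark_law = sets mark_space"
  unfolding mark_law_def by (intro sets_pair_measure_cong) simp_all

lemma sets_tree_law [measurable_cong]: "sets tree_law = sets tree_space"
  unfolding tree_law_def by (intro sets_PiM_cong sets_mark_law refl)

lemma space_mark_law: "space mark_law = UNIV"
  using sets_eq_imp_space_eq[OF sets_mark_law] by (simp add: space_pair_measure)

lemma space_tree_law: "space tree_law = UNIV"
  by (simp add: tree_law_def space_PiM space_mark_law)

sublocale mark_law: prob_space mark_law
  unfolding mark_law_def by (intro prob_space_pair prob_space_measure_pmf step.prob_space_axioms)

sublocale tree_law: product_prob_space "\<lambda>_ :: nat list. mark_law" UNIV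
  rewrites "PiM UNIV (\<lambda>_. mark_law) = tree_law"
  by unfold_locales (rule tree_law_def[symmetric])

lemma measurable_coordinate [measurable]: "(\<lambda>x. x w) \<in> tree_law \<rightarrow>\<^sub>M mark_law"
  unfolding tree_law_def by measurable

lemma measurable_subtree_tree_law [measurable]: "subtree j \<in> tree_law \<rightarrow>\<^sub>M tree_law"
  unfolding tree_law_def by (rule measurable_subtree) simp

lemma distr_root_offspring: "distr tree_law (count_space UNIV) (\<lambda>x. fst (x [])) = measure_pmf p"
proof -
  have "distr tree_law (count_space UNIV) (\<lambda>x. fst (x []))
      = distr (distr tree_law mark_law (\<lambda>x. x [])) (count_space UNIV) fst"
    by (subst distr_distr) (auto simp: comp_def)
  also have "\<dots> = distr mark_law (measure_pmf p) fst"
    unfolding tree_law.PiM_component[OF UNIV_I] by (rule distr_cong) auto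
  finally show ?thesis unfolding mark_law_def by (simp add: step.distr_pair_fst)
qed

lemma distr_subtree: "distr tree_law tree_law (subtree j) = tree_law"
proof -
  have "distr tree_law tree_law (\<lambda>x. \<lambda>w\<in>UNIV. x (j # w)) = tree_law"
    using distr_PiM_reindex[of UNIV "\<lambda>_. mark_law" "Cons j" UNIV] mark_law.prob_space_axioms
    by (simp flip: tree_law_def)
  then show ?thesis by (simp add: subtree_def[abs_def] restrict_UNIV)
qed

lemma prob_root_offspring: "\<P>(x in tree_law. fst (x []) = k) = pmf p k"
  by (subst pmf.rep_eq, subst distr_root_offspring[symmetric], subst measure_distr)
    (auto simp: vimage_def Int_def conj_commute)

lemma prob_subtree_in:
  assumes "G \<in> sets tree_law"
  shows "\<P>(x in tree_law. subtree j x \<in> G) = tree_law.prob G"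
  using measure_distr[OF measurable_subtree_tree_law assms, of j]
  by (simp add: distr_subtree vimage_def Int_def conj_commute)

lemma indep_blocks:
  assumes "disjoint_family_on block J"
  shows "tree_law.indep_vars (\<lambda>j. PiM (block j) (\<lambda>_. mark_law)) (\<lambda>j x. restrict x (block j)) J"
proof -
  have "tree_law.indep_vars (\<lambda>_. mark_law) (\<lambda>w x. x w) UNIV"
    unfolding tree_law_def by (intro indep_vars_PiM_coordinates mark_law.prob_space_axioms)
  then show ?thesis using assms by (intro tree_law.indep_vars_restrict) auto
qed

theorem branching_property:
  assumes I: "finite I" and G: "G \<in> sets tree_law"
  shows "\<P>(x in tree_law. fst (x []) = k \<and> (\<forall>j\<in>I. subtree j x \<in> G))
    = pmf p k * tree_law.prob G ^ card I"
proof -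
  define block :: "nat option \<Rightarrow> nat list set"
    where "block j = (case j of None \<Rightarrow> {[]} | Some i \<Rightarrow> range (Cons i))" for j
  define A where "A j = (case j of None \<Rightarrow> {y \<in> space (PiM {[]} (\<lambda>_. mark_law)). fst (y []) = k}
      | Some i \<Rightarrow> subtree i -` G \<inter> space (PiM (range (Cons i)) (\<lambda>_. mark_law)))" for j :: "nat option"
  define E where "E j = (\<lambda>x. restrict x (block j)) -` A j \<inter> space tree_law" for j
  have A_sets: "A j \<in> sets (PiM (block j) (\<lambda>_. mark_law))" for j
  proof (cases j)
    case None
    have "(\<lambda>y. y []) \<in> PiM {[]} (\<lambda>_. mark_law) \<rightarrow>\<^sub>M mark_law"
      by (rule measurable_component_singleton) simp
    then show ?thesis by (simp add: None A_def block_def)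
  next
    case (Some i)
    have "subtree i \<in> PiM (range (Cons i)) (\<lambda>_. mark_law) \<rightarrow>\<^sub>M tree_law"
      unfolding tree_law_def by (rule measurable_subtree) simp
    then show ?thesis using G by (simp add: Some A_def block_def measurable_sets)
  qed
  have "tree_law.indep_vars (\<lambda>j. PiM (block j) (\<lambda>_. mark_law)) (\<lambda>j x. restrict x (block j)) UNIV"
    by (rule indep_blocks) (auto simp: disjoint_family_on_def block_def split: option.splits)
  then have "tree_law.prob (\<Inter>j\<in>insert None (Some ` I). E j)
      = (\<Prod>j\<in>insert None (Some ` I). tree_law.prob (E j))"
    unfolding E_def using I A_sets by (intro tree_law.indep_varsD) auto
  moreover have E_None: "E None = {x \<in> space tree_law. fst (x []) = k}"
    by (auto simp: E_def A_def block_def space_tree_law space_PiM space_mark_law)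
  moreover have E_Some: "E (Some i) = {x \<in> space tree_law. subtree i x \<in> G}" for i
    by (auto simp: E_def A_def block_def space_tree_law space_PiM space_mark_law subtree_def)
  moreover have "(\<Inter>j\<in>insert None (Some ` I). E j)
      = {x \<in> space tree_law. fst (x []) = k \<and> (\<forall>j\<in>I. subtree j x \<in> G)}"
    by (auto simp: E_None E_Some)
  ultimately show ?thesis using I G by (simp add: prod.reindex prob_root_offspring prob_subtree_in)
qed

lemma prob_all_subtrees:
  assumes G: "G \<in> sets tree_law"
  shows "\<P>(x in tree_law. \<forall>j<fst (x []). subtree j x \<in> G) = pgf p (tree_law.prob G)"
proof -
  define q where "q = tree_law.prob G"
  have q: "0 \<le> q" "q \<le> 1" by (auto simp: q_def)
  note [measurable] = G
  have "\<P>(x in tree_law. {..<fst (x [])} = I \<and> (\<forall>j\<in>I. subtree j x \<in> G))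
      = \<P>(x in tree_law. {..<fst (x [])} = I) * q ^ card I" if "finite I" for I
  proof (cases "\<exists>k. I = {..<k}")
    case True
    then obtain k where "I = {..<k}" by blast
    then show ?thesis
      using branching_property[of I G k] branching_property[of "{}" G k] G by (simp add: q_def)
  next
    case False
    then have "{..<m} \<noteq> I" for m by auto
    then show ?thesis by simp
  qed
  then have "emeasure tree_law {x \<in> space tree_law. \<forall>j\<in>{..<fst (x [])}. subtree j x \<in> G}
      = (\<integral>\<^sup>+x. ennreal (q ^ card {..<fst (x [])}) \<partial>tree_law)"
    using q by (intro tree_law.emeasure_all_in_random_index_set) auto
  also have "\<dots> = (\<integral>\<^sup>+k. ennreal (q ^ k) \<partial>distr tree_law (count_space UNIV) (\<lambda>x. fst (x [])))"
    by (subst nn_integral_distr) auto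
  also have "\<dots> = ennreal (pgf p q)"
    unfolding distr_root_offspring using q by (rule nn_integral_pgf)
  finally show ?thesis using q by (simp add: tree_law.emeasure_eq_measure pgf_nonneg q_def Ball_def)
qed

lemma prob_extinct: "\<P>(x in tree_law. tree_gen n x = {}) = (pgf p ^^ n) 0"
proof (induction n)
  case (Suc n)
  define G where "G = {x \<in> space tree_law. tree_gen n x = {}}"
  have "G \<in> sets tree_law" unfolding G_def by measurable
  have "\<P>(x in tree_law. tree_gen (Suc n) x = {})
      = \<P>(x in tree_law. \<forall>j<fst (x []). subtree j x \<in> G)"
    by (simp add: tree_gen_Suc_empty_iff G_def space_tree_law)
  also have "\<dots> = pgf p (tree_law.prob G)"
    by (rule prob_all_subtrees) fact
  finally show ?case by (simp add: G_def Suc)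
qed (simp add: tree_gen_0)

definition label_weight :: "nat list \<Rightarrow> ennreal" where
  "label_weight v = (\<Prod>j<length v. emeasure (measure_pmf p) {k. v ! j < k})"

abbreviation offspring_mean :: ennreal where
  "offspring_mean \<equiv> \<integral>\<^sup>+k. of_nat k \<partial>measure_pmf p"

lemma nn_integral_label_weight:
  "(\<integral>\<^sup>+v. label_weight v \<partial>count_space {v. length v = n}) = offspring_mean ^ n"
proof -
  have "(\<integral>\<^sup>+v. label_weight v \<partial>count_space {v. length v = n})
      = (\<integral>\<^sup>+v. (\<Prod>j<n. emeasure (measure_pmf p) {k. v ! j < k}) \<partial>count_space {v. length v = n})"
    by (rule nn_integral_cong) (simp add: label_weight_def)
  also have "\<dots> = (\<Sum>j. emeasure (measure_pmf p) {k. j < k}) ^ n"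
    by (rule nn_integral_prod_lists)
  also have "(\<Sum>j. emeasure (measure_pmf p) {k. j < k}) = offspring_mean"
    using nn_integral_nat_function[of "\<lambda>k. k" "measure_pmf p"] by simp
  finally show ?thesis .
qed

definition path_steps :: "nat list \<Rightarrow> (nat list \<Rightarrow> nat \<times> real) \<Rightarrow> nat \<Rightarrow> real" where
  "path_steps v x = (\<lambda>j\<in>{..<length v}. snd (x (take (Suc j) v)))"

lemma emeasure_prefix_box:
  assumes v: "length v = n" and C: "\<And>j. j \<le> n \<Longrightarrow> C j \<in> sets borel"
  shows "emeasure tree_law {x \<in> space tree_law. \<forall>j\<le>n. x (take j v) \<in> B j \<times> C j}
    = (\<Prod>j\<le>n. emeasure (measure_pmf p) (B j)) * (\<Prod>j\<le>n. emeasure \<mu> (C j))"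
proof -
  have inj: "inj_on (\<lambda>j. take j v) {..n}"
    using v by (intro inj_onI) (metis atMost_iff length_take min_absorb2)
  have "{x \<in> space tree_law. \<forall>j\<le>n. x (take j v) \<in> B j \<times> C j}
      = {x \<in> space tree_law. \<forall>w\<in>(\<lambda>j. take j v) ` {..n}. x w \<in> B (length w) \<times> C (length w)}"
    using v by auto
  also have "emeasure tree_law \<dots>
      = (\<Prod>w\<in>(\<lambda>j. take j v) ` {..n}. emeasure mark_law (B (length w) \<times> C (length w)))"
    using v C by (intro tree_law.emeasure_PiM_Collect) (auto simp: sets_mark_law)
  also have "\<dots> = (\<Prod>j\<le>n. emeasure mark_law (B j \<times> C j))"
    using v by (simp add: prod.reindex[OF inj] cong: prod.cong_simp)
  also have "\<dots> = (\<Prod>j\<le>n. emeasure (measure_pmf p) (B j)) * (\<Prod>j\<le>n. emeasure \<mu> (C j))"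
    unfolding prod.distrib[symmetric] mark_law_def
    using C by (intro prod.cong refl step.emeasure_pair_measure_Times) auto
  finally show ?thesis .
qed

lemma emeasure_alive_steps_box:
  assumes v: "length v = n" and A: "\<And>j. j < n \<Longrightarrow> A j \<in> sets borel"
  shows "emeasure tree_law
      {x \<in> space tree_law. v \<in> tree_gen n x \<and> (\<forall>j<n. snd (x (take (Suc j) v)) \<in> A j)}
    = label_weight v * (\<Prod>j<n. emeasure \<mu> (A j))"
proof -
  define B where "B j = (if j < n then {k. v ! j < k} else UNIV)" for j
  define C where "C j = (case j of 0 \<Rightarrow> UNIV | Suc i \<Rightarrow> A i)" for j
  have "(\<forall>j\<le>n. x (take j v) \<in> B j \<times> C j)
      \<longleftrightarrow> (\<forall>j\<le>n. fst (x (take j v)) \<in> B j) \<and> (\<forall>j\<le>n. snd (x (take j v)) \<in> C j)"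
    for x :: "nat list \<Rightarrow> nat \<times> real"
    by (auto simp: mem_Times_iff)
  moreover have "(\<forall>j\<le>n. fst (x (take j v)) \<in> B j) \<longleftrightarrow> (\<forall>j<n. v ! j < fst (x (take j v)))"
    for x :: "nat list \<Rightarrow> nat \<times> real"
    by (auto simp: B_def)
  moreover have "(\<forall>j\<le>n. snd (x (take j v)) \<in> C j) \<longleftrightarrow> (\<forall>j<n. snd (x (take (Suc j) v)) \<in> A j)"
    for x :: "nat list \<Rightarrow> nat \<times> real"
    unfolding less_Suc_eq_le[symmetric] All_less_Suc2 by (simp add: C_def)
  ultimately have "{x \<in> space tree_law. v \<in> tree_gen n x \<and> (\<forall>j<n. snd (x (take (Suc j) v)) \<in> A j)}
      = {x \<in> space tree_law. \<forall>j\<le>n. x (take j v) \<in> B j \<times> C j}"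
    using v by (simp add: tree_gen_def)
  also have "emeasure tree_law \<dots>
      = (\<Prod>j\<le>n. emeasure (measure_pmf p) (B j)) * (\<Prod>j\<le>n. emeasure \<mu> (C j))"
    using v A by (intro emeasure_prefix_box) (auto simp: C_def split: nat.split)
  also have "(\<Prod>j\<le>n. emeasure (measure_pmf p) (B j)) = label_weight v"
    using v by (simp add: B_def label_weight_def flip: lessThan_Suc_atMost)
  also have "(\<Prod>j\<le>n. emeasure \<mu> (C j)) = (\<Prod>j<n. emeasure \<mu> (A j))"
    using step.emeasure_space_1
    by (simp add: C_def prod.lessThan_Suc_shift del: prod.lessThan_Suc flip: lessThan_Suc_atMost)
  finally show ?thesis .
qed

lemma emeasure_alive_steps:
  assumes v: "length v = n" and Y: "Y \<in> sets (PiM {..<n} (\<lambda>_. \<mu>))"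
  shows "emeasure tree_law {x \<in> space tree_law. v \<in> tree_gen n x \<and> path_steps v x \<in> Y}
    = label_weight v * emeasure (PiM {..<n} (\<lambda>_. \<mu>)) Y"
proof -
  interpret walk: product_sigma_finite "\<lambda>_ :: nat. \<mu>" ..
  define alive where "alive = {x \<in> space tree_law. v \<in> tree_gen n x}"
  define walk_space where "walk_space = PiM {..<n} (\<lambda>_. \<mu>)"
  define steps_law where "steps_law
      = distr (density tree_law (indicator alive)) walk_space (path_steps v)"
  have alive [measurable]: "alive \<in> sets tree_law" unfolding alive_def by measurable
  have steps [measurable]: "path_steps v \<in> tree_law \<rightarrow>\<^sub>M walk_space"
    unfolding path_steps_def[abs_def] walk_space_def v by (intro measurable_restrict) measurable
  have steps_law: "emeasure steps_law Y
      = emeasure tree_law {x \<in> space tree_law. v \<in> tree_gen n x \<and> path_steps v x \<in> Y}"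
    if "Y \<in> sets walk_space" for Y
  proof -
    have "emeasure steps_law Y
        = emeasure (density tree_law (indicator alive)) (path_steps v -` Y \<inter> space tree_law)"
      unfolding steps_law_def using that by (subst emeasure_distr) auto
    also have "\<dots> = emeasure tree_law (alive \<inter> (path_steps v -` Y \<inter> space tree_law))"
      using that by (intro emeasure_restricted measurable_sets[OF steps]) auto
    finally show ?thesis by (simp add: alive_def Int_def conj_ac)
  qed
  have "steps_law = scale_measure (label_weight v) walk_space"
  proof (rule measure_eqI_PiM_finite[of "{..<n}" _ "\<lambda>_. \<mu>"])
    fix A :: "nat \<Rightarrow> real set" assume A: "\<And>j. j \<in> {..<n} \<Longrightarrow> A j \<in> sets \<mu>"
    have box: "Pi\<^sub>E {..<n} A \<in> sets walk_space"
      unfolding walk_space_def using A by (intro sets_PiM_I_finite) auto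
    have "path_steps v x \<in> Pi\<^sub>E {..<n} A \<longleftrightarrow> (\<forall>j<n. snd (x (take (Suc j) v)) \<in> A j)" for x
      using v by (auto simp: path_steps_def)
    then show "emeasure steps_law (Pi\<^sub>E {..<n} A)
        = emeasure (scale_measure (label_weight v) walk_space) (Pi\<^sub>E {..<n} A)"
      using A v emeasure_alive_steps_box[OF v, of A] walk.emeasure_PiM[of "{..<n}" A]
      by (simp add: steps_law[OF box] walk_space_def)
  next
    show "range (\<lambda>_ :: nat. space walk_space) \<subseteq> prod_algebra {..<n} (\<lambda>_. \<mu>)"
      unfolding walk_space_def space_PiM by (auto intro: prod_algebraI_finite)
    show "emeasure steps_law (space walk_space) \<noteq> \<infinity>"
      by (simp add: steps_law)
  qed (simp_all add: steps_law_def walk_space_def)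
  then show ?thesis using steps_law[of Y] Y by (simp add: walk_space_def)
qed

lemma emeasure_alive_disp:
  assumes v: "length v = n" and S: "S \<in> sets borel"
  shows "emeasure tree_law {x \<in> space tree_law. v \<in> tree_gen n x \<and> tree_disp v x \<in> S}
    = label_weight v * emeasure (random_walk_law \<mu> n) S"
proof -
  have walk [measurable]: "(\<lambda>y. \<Sum>j<n. y j) \<in> borel_measurable (PiM {..<n} (\<lambda>_. \<mu>))"
    by measurable
  define Y where "Y = (\<lambda>y. \<Sum>j<n. y j) -` S \<inter> space (PiM {..<n} (\<lambda>_. \<mu>))"
  have Y: "Y \<in> sets (PiM {..<n} (\<lambda>_. \<mu>))"
    unfolding Y_def using walk S by (rule measurable_sets)
  have "path_steps v x \<in> Y \<longleftrightarrow> tree_disp v x \<in> S" for x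
    using v by (simp add: Y_def path_steps_def tree_disp_def space_PiM)
  then show ?thesis
    using emeasure_alive_steps[OF v Y] S by (simp add: random_walk_law_def emeasure_distr Y_def)
qed

theorem many_to_one:
  assumes S: "S \<in> sets borel"
  shows "(\<integral>\<^sup>+v. emeasure tree_law {x \<in> space tree_law. v \<in> tree_gen n x \<and> tree_disp v x \<in> S}
      \<partial>count_space {v. length v = n})
    = offspring_mean ^ n * emeasure (random_walk_law \<mu> n) S"
proof -
  have "(\<integral>\<^sup>+v. emeasure tree_law {x \<in> space tree_law. v \<in> tree_gen n x \<and> tree_disp v x \<in> S}
      \<partial>count_space {v. length v = n})
    = (\<integral>\<^sup>+v. label_weight v * emeasure (random_walk_law \<mu> n) S \<partial>count_space {v. length v = n})"
    using S by (intro nn_integral_cong emeasure_alive_disp) auto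
  then show ?thesis by (simp add: nn_integral_multc nn_integral_label_weight)
qed

lemma emeasure_some_particle_disp_le:
  assumes S: "S \<in> sets borel"
  shows "emeasure tree_law {x \<in> space tree_law. \<exists>v\<in>tree_gen n x. tree_disp v x \<in> S}
    \<le> offspring_mean ^ n * emeasure (random_walk_law \<mu> n) S"
proof -
  note [measurable] = S
  have "{x \<in> space tree_law. \<exists>v\<in>tree_gen n x. tree_disp v x \<in> S}
      = (\<Union>v\<in>{v. length v = n}. {x \<in> space tree_law. v \<in> tree_gen n x \<and> tree_disp v x \<in> S})"
    by (auto simp: tree_gen_def)
  then show ?thesis
    using emeasure_UN_countable_le[of "{v :: nat list. length v = n}"
        "\<lambda>v. {x \<in> space tree_law. v \<in> tree_gen n x \<and> tree_disp v x \<in> S}" tree_law]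
    by (simp add: many_to_one[OF S])
qed

end

subsection \<open>Poisson initial configuration\<close>

lemma (in sigma_finite_measure) emeasure_distr_count_space_pair:
  fixes X :: "nat \<Rightarrow> 'a \<Rightarrow> 'b"
  assumes [measurable]: "\<And>i. X i \<in> M \<rightarrow>\<^sub>M N" "A \<in> sets N"
  shows "emeasure (distr (count_space UNIV \<Otimes>\<^sub>M M) N (\<lambda>(i, \<omega>). X i \<omega>)) A
    = (\<Sum>i. emeasure M {\<omega> \<in> space M. X i \<omega> \<in> A})"
proof -
  have X: "(\<lambda>(i, \<omega>). X i \<omega>) \<in> count_space UNIV \<Otimes>\<^sub>M M \<rightarrow>\<^sub>M N"
    by (rule measurable_pair_measure_countable1) auto
  have "emeasure (distr (count_space UNIV \<Otimes>\<^sub>M M) N (\<lambda>(i, \<omega>). X i \<omega>)) A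
      = (\<integral>\<^sup>+i. emeasure M (Pair i -` ((\<lambda>(i, \<omega>). X i \<omega>) -` A \<inter> space (count_space UNIV \<Otimes>\<^sub>M M)))
          \<partial>count_space UNIV)"
    using X by (simp add: emeasure_distr emeasure_pair_measure_alt measurable_sets)
  also have "\<dots> = (\<Sum>i. emeasure M {\<omega> \<in> space M. X i \<omega> \<in> A})"
    by (simp add: nn_integral_count_space_nat space_pair_measure vimage_def Int_def conj_commute)
  finally show ?thesis .
qed

locale poisson_forest = branching_random_walk p \<mu> + prob_space M
  for p \<mu> and M :: "'a measure" +
  fixes \<xi> :: "nat \<Rightarrow> 'a \<Rightarrow> real" and K :: "nat \<Rightarrow> nat list \<Rightarrow> 'a \<Rightarrow> nat"
    and D :: "nat \<Rightarrow> nat list \<Rightarrow> 'a \<Rightarrow> real"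
  assumes poisson_points: "poisson_point_seq M \<xi>"
    and indep_case_prod_marks: "indep_vars (\<lambda>_. mark_space) (\<lambda>(i, v) \<omega>. (K i v \<omega>, D i v \<omega>)) UNIV"
    and distr_mark: "\<And>i v. distr M mark_space (\<lambda>\<omega>. (K i v \<omega>, D i v \<omega>)) = measure_pmf p \<Otimes>\<^sub>M \<mu>"
    and indep_set_points_marks: "indep_set
        {(\<lambda>\<omega> i. \<xi> i \<omega>) -` S \<inter> space M | S. S \<in> sets (Pi\<^sub>M UNIV (\<lambda>_. borel))}
        {(\<lambda>\<omega> (iv :: nat \<times> nat list). (K (fst iv) (snd iv) \<omega>, D (fst iv) (snd iv) \<omega>)) -` S \<inter> space M
           | S. S \<in> sets (Pi\<^sub>M UNIV (\<lambda>_. mark_space))}"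
begin

abbreviation marks :: "'a \<Rightarrow> nat \<times> nat list \<Rightarrow> nat \<times> real" where
  "marks \<equiv> \<lambda>\<omega> iv. (K (fst iv) (snd iv) \<omega>, D (fst iv) (snd iv) \<omega>)"

definition tree :: "nat \<Rightarrow> 'a \<Rightarrow> nat list \<Rightarrow> nat \<times> real" where
  "tree i \<omega> = (\<lambda>v. marks \<omega> (i, v))"

lemma indep_marks: "indep_vars (\<lambda>_. mark_space) (\<lambda>iv \<omega>. marks \<omega> iv) UNIV"
  using indep_case_prod_marks by (simp add: case_prod_unfold)

lemma measurable_mark [measurable]: "(\<lambda>\<omega>. (K i v \<omega>, D i v \<omega>)) \<in> M \<rightarrow>\<^sub>M mark_space"
  using indep_marks by (force simp: indep_vars_def)

lemma measurable_row: "(\<lambda>x v. x (i, v)) \<in> PiM ({i} \<times> UNIV) (\<lambda>_. mark_space) \<rightarrow>\<^sub>M tree_space"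
  by (rule measurable_PiM_single')
    (auto intro: measurable_component_singleton simp: space_pair_measure)

lemma measurable_rows: "(\<lambda>x i v. x (i, v)) \<in> PiM UNIV (\<lambda>_. mark_space) \<rightarrow>\<^sub>M PiM UNIV (\<lambda>_. tree_space)"
  by (intro measurable_PiM_single') (auto simp: space_PiM space_pair_measure)

lemma indep_trees: "indep_vars (\<lambda>_. tree_space) tree UNIV"
proof -
  have "indep_vars (\<lambda>i. PiM ({i} \<times> UNIV) (\<lambda>_. mark_space))
      (\<lambda>i \<omega>. restrict (marks \<omega>) ({i} \<times> UNIV)) UNIV"
    by (rule indep_vars_restrict[OF indep_marks]) (auto simp: disjoint_family_on_def)
  then have "indep_vars (\<lambda>_. tree_space) (\<lambda>i \<omega> v. restrict (marks \<omega>) ({i} \<times> UNIV) (i, v)) UNIV"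
    by (rule indep_vars_compose2) (rule measurable_row)
  then show ?thesis by (simp add: tree_def[abs_def])
qed

lemma measurable_tree [measurable]: "tree i \<in> M \<rightarrow>\<^sub>M tree_space"
  using indep_trees by (auto simp: indep_vars_def)

lemma distr_tree: "distr M tree_space (tree i) = tree_law"
proof -
  have "indep_vars (\<lambda>v. PiM {(i, v)} (\<lambda>_. mark_space)) (\<lambda>v \<omega>. restrict (marks \<omega>) {(i, v)}) UNIV"
    by (rule indep_vars_restrict[OF indep_marks]) (auto simp: disjoint_family_on_def)
  then have "indep_vars (\<lambda>_. mark_space) (\<lambda>v \<omega>. restrict (marks \<omega>) {(i, v)} (i, v)) UNIV"
    by (rule indep_vars_compose2) (rule measurable_component_singleton, simp)
  then have "indep_vars (\<lambda>_. mark_space) (\<lambda>v \<omega>. marks \<omega> (i, v)) UNIV" by simp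
  then have "distr M tree_space (\<lambda>\<omega>. \<lambda>v\<in>UNIV. marks \<omega> (i, v))
      = PiM UNIV (\<lambda>v. distr M mark_space (\<lambda>\<omega>. marks \<omega> (i, v)))"
    by (subst (asm) indep_vars_iff_distr_eq_PiM) auto
  then show ?thesis
    by (simp add: tree_def[abs_def] distr_mark tree_law_def mark_law_def restrict_UNIV)
qed

lemma prob_tree_in:
  assumes "G \<in> sets tree_space"
  shows "\<P>(\<omega> in M. tree i \<omega> \<in> G) = tree_law.prob G"
  using measure_distr[OF measurable_tree assms, of i]
  by (simp add: distr_tree vimage_def Int_def conj_commute)

lemma prob_all_trees_in:
  assumes I: "finite I" and G: "G \<in> sets tree_space"
  shows "\<P>(\<omega> in M. \<forall>i\<in>I. tree i \<omega> \<in> G) = tree_law.prob G ^ card I"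
proof (cases "I = {}")
  case False
  have "{\<omega> \<in> space M. \<forall>i\<in>I. tree i \<omega> \<in> G} = (\<Inter>i\<in>I. tree i -` G \<inter> space M)"
    using False by auto
  then have "\<P>(\<omega> in M. \<forall>i\<in>I. tree i \<omega> \<in> G) = (\<Prod>i\<in>I. \<P>(\<omega> in M. tree i \<omega> \<in> G))"
    using indep_varsD[OF indep_trees False I] G by (simp add: vimage_def Int_def conj_commute)
  then show ?thesis using G by (simp add: prob_tree_in)
qed (simp add: prob_space)

lemma measurable_point [measurable]: "\<xi> i \<in> borel_measurable M"
  using poisson_points by (simp add: poisson_point_seq_def)

lemma prob_points_and_trees_in:
  assumes S: "S \<in> sets (PiM UNIV (\<lambda>_. borel))" and T: "T \<in> sets (PiM UNIV (\<lambda>_. tree_space))"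
  shows "\<P>(\<omega> in M. (\<lambda>i. \<xi> i \<omega>) \<in> S \<and> (\<lambda>i. tree i \<omega>) \<in> T)
    = \<P>(\<omega> in M. (\<lambda>i. \<xi> i \<omega>) \<in> S) * \<P>(\<omega> in M. (\<lambda>i. tree i \<omega>) \<in> T)"
proof -
  define rows where "rows = (\<lambda>(x :: nat \<times> nat list \<Rightarrow> nat \<times> real) i v. x (i, v))"
  define T' where "T' = rows -` T \<inter> space (PiM UNIV (\<lambda>_. mark_space))"
  have "T' \<in> sets (PiM UNIV (\<lambda>_. mark_space))"
    unfolding T'_def rows_def using measurable_rows T by (rule measurable_sets)
  then have "prob (((\<lambda>\<omega> i. \<xi> i \<omega>) -` S \<inter> space M) \<inter> (marks -` T' \<inter> space M))
      = prob ((\<lambda>\<omega> i. \<xi> i \<omega>) -` S \<inter> space M) * prob (marks -` T' \<inter> space M)"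
    using S by (intro indep_setD[OF indep_set_points_marks]) blast+
  moreover have "(\<lambda>\<omega> i. \<xi> i \<omega>) -` S \<inter> space M = {\<omega> \<in> space M. (\<lambda>i. \<xi> i \<omega>) \<in> S}" by auto
  moreover have "marks -` T' \<inter> space M = {\<omega> \<in> space M. (\<lambda>i. tree i \<omega>) \<in> T}"
    by (auto simp: T'_def rows_def tree_def[abs_def] space_PiM space_pair_measure)
  moreover have "{\<omega> \<in> space M. (\<lambda>i. \<xi> i \<omega>) \<in> S} \<inter> {\<omega> \<in> space M. (\<lambda>i. tree i \<omega>) \<in> T}
      = {\<omega> \<in> space M. (\<lambda>i. \<xi> i \<omega>) \<in> S \<and> (\<lambda>i. tree i \<omega>) \<in> T}" by auto
  ultimately show ?thesis by (simp only:)
qed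

lemma prob_point_and_tree_in:
  assumes A: "A \<in> sets borel" and B: "B \<in> sets tree_space"
  shows "\<P>(\<omega> in M. \<xi> i \<omega> \<in> A \<and> tree i \<omega> \<in> B) = \<P>(\<omega> in M. \<xi> i \<omega> \<in> A) * tree_law.prob B"
proof -
  note [measurable] = A B
  have "{x \<in> space (PiM UNIV (\<lambda>_. borel :: real measure)). x i \<in> A} \<in> sets (PiM UNIV (\<lambda>_. borel))"
    "{x \<in> space (PiM UNIV (\<lambda>_. tree_space)). x i \<in> B} \<in> sets (PiM UNIV (\<lambda>_. tree_space))"
    by measurable
  from prob_points_and_trees_in[OF this] show ?thesis
    using B by (simp add: space_PiM space_pair_measure prob_tree_in)
qed

lemma finite_points_in:
  assumes "A \<in> sets borel" "bounded A"
  shows "AE \<omega> in M. finite {i. \<xi> i \<omega> \<in> A}"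
  using poisson_points assms by (simp add: poisson_point_seq_def)

lemma distr_card_points_in:
  assumes "A \<in> sets borel" "bounded A"
  shows "distr M (count_space UNIV) (\<lambda>\<omega>. card {i. \<xi> i \<omega> \<in> A})
    = measure_pmf (poisson_pmf (measure lborel A))"
  using poisson_points assms by (simp add: poisson_point_seq_def)

lemma measurable_card_points_in:
  assumes "A \<in> sets borel" "bounded A"
  shows "(\<lambda>\<omega>. card {i. \<xi> i \<omega> \<in> A}) \<in> M \<rightarrow>\<^sub>M count_space UNIV"
proof -
  have "indep_vars (\<lambda>_. count_space UNIV) (\<lambda>j \<omega>. card {i. \<xi> i \<omega> \<in> A}) {..<Suc 0}"
    using poisson_points assms unfolding poisson_point_seq_def
    by (elim conjE allE[where x = "Suc 0"] allE[where x = "\<lambda>_. A"])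
      (auto simp: disjoint_family_on_def)
  then show ?thesis by (auto simp: indep_vars_def)
qed

lemma nn_integral_card_points_in:
  assumes "A \<in> sets borel" "bounded A"
  shows "(\<integral>\<^sup>+\<omega>. f (card {i. \<xi> i \<omega> \<in> A}) \<partial>M)
    = (\<integral>\<^sup>+k. f k \<partial>measure_pmf (poisson_pmf (measure lborel A)))"
  unfolding distr_card_points_in[OF assms, symmetric]
  by (subst nn_integral_distr[OF measurable_card_points_in[OF assms]]) auto

theorem prob_trees_rooted_in:
  assumes A: "A \<in> sets borel" "bounded A" "0 < measure lborel A" and G: "G \<in> sets tree_space"
  shows "\<P>(\<omega> in M. \<forall>i. \<xi> i \<omega> \<in> A \<longrightarrow> tree i \<omega> \<in> G) = exp (- (1 - tree_law.prob G) * measure lborel A)"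
proof -
  define q where "q = tree_law.prob G"
  have q: "0 \<le> q" "q \<le> 1" by (auto simp: q_def)
  note [measurable] = A(1) G
  have "\<P>(\<omega> in M. {i. \<xi> i \<omega> \<in> A} = I \<and> (\<forall>i\<in>I. tree i \<omega> \<in> G))
      = \<P>(\<omega> in M. {i. \<xi> i \<omega> \<in> A} = I) * q ^ card I"
    if "finite I" for I
  proof -
    have "{x \<in> space (PiM UNIV (\<lambda>_. borel :: real measure)). \<forall>i. x i \<in> A \<longleftrightarrow> i \<in> I}
        \<in> sets (PiM UNIV (\<lambda>_. borel))"
      "{x \<in> space (PiM UNIV (\<lambda>_. tree_space)). \<forall>i\<in>I. x i \<in> G} \<in> sets (PiM UNIV (\<lambda>_. tree_space))"
      by measurable
    from prob_points_and_trees_in[OF this] prob_all_trees_in[OF that G] show ?thesis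
      by (simp add: space_PiM space_pair_measure set_eq_iff q_def)
  qed
  then have "emeasure M {\<omega> \<in> space M. \<forall>i\<in>{i. \<xi> i \<omega> \<in> A}. tree i \<omega> \<in> G}
      = (\<integral>\<^sup>+\<omega>. ennreal (q ^ card {i. \<xi> i \<omega> \<in> A}) \<partial>M)"
    using q A by (intro emeasure_all_in_random_index_set finite_points_in) auto
  also have "\<dots> = ennreal (pgf (poisson_pmf (measure lborel A)) q)"
    using nn_integral_card_points_in[OF A(1,2), of "\<lambda>k. ennreal (q ^ k)"] q
    by (simp add: nn_integral_pgf)
  also have "\<dots> = ennreal (exp (- (1 - q) * measure lborel A))"
    using q A(3) by (simp add: pgf_poisson)
  finally show ?thesis by (simp add: emeasure_eq_measure q_def Ball_def)
qed

lemma suminf_emeasure_point_in: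
  assumes A: "A \<in> sets borel" "bounded A" "0 < measure lborel A"
  shows "(\<Sum>i. emeasure M {\<omega> \<in> space M. \<xi> i \<omega> \<in> A}) = ennreal (measure lborel A)"
proof -
  note [measurable] = A(1)
  have "(\<Sum>i. emeasure M {\<omega> \<in> space M. \<xi> i \<omega> \<in> A}) = (\<Sum>i. \<integral>\<^sup>+\<omega>. indicator A (\<xi> i \<omega>) \<partial>M)"
    by (intro suminf_cong)
      (auto simp: indicator_def of_bool_def simp flip: nn_integral_indicator intro!: nn_integral_cong)
  also have "\<dots> = (\<integral>\<^sup>+\<omega>. (\<Sum>i. indicator A (\<xi> i \<omega>)) \<partial>M)"
    by (rule nn_integral_suminf[symmetric]) measurable
  also have "\<dots> = (\<integral>\<^sup>+\<omega>. of_nat (card {i. \<xi> i \<omega> \<in> A}) \<partial>M)"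
  proof (rule nn_integral_cong_AE)
    from finite_points_in[OF A(1,2)]
    show "AE \<omega> in M. (\<Sum>i. indicator A (\<xi> i \<omega>) :: ennreal) = of_nat (card {i. \<xi> i \<omega> \<in> A})"
    proof eventually_elim
      case (elim \<omega>)
      then have "(\<Sum>i. indicator A (\<xi> i \<omega>) :: ennreal) = (\<Sum>i\<in>{i. \<xi> i \<omega> \<in> A}. indicator A (\<xi> i \<omega>))"
        by (rule suminf_finite) auto
      then show ?case by simp
    qed
  qed
  also have "\<dots> = ennreal (measure lborel A)"
    using A by (simp add: nn_integral_card_points_in nn_integral_poisson_mean)
  finally show ?thesis .
qed

lemma distr_points_eq_lborel: "distr (count_space UNIV \<Otimes>\<^sub>M M) borel (\<lambda>(i, \<omega>). \<xi> i \<omega>) = lborel"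
proof (rule lborel_eqI[symmetric])
  fix l u :: real assume "\<And>b. b \<in> Basis \<Longrightarrow> l \<bullet> b \<le> u \<bullet> b"
  then have "l \<le> u" by simp
  then show "emeasure (distr (count_space UNIV \<Otimes>\<^sub>M M) borel (\<lambda>(i, \<omega>). \<xi> i \<omega>)) (box l u)
      = (\<Prod>b\<in>Basis. (u - l) \<bullet> b)"
    using suminf_emeasure_point_in[of "{l<..<u}"]
    by (cases "l = u") (simp_all add: emeasure_distr_count_space_pair bounded_Ioo)
qed simp

theorem campbell:
  "distr (count_space UNIV \<Otimes>\<^sub>M M) (borel \<Otimes>\<^sub>M tree_space) (\<lambda>(i, \<omega>). (\<xi> i \<omega>, tree i \<omega>))
      = lborel \<Otimes>\<^sub>M tree_law"
proof (rule pair_measure_eqI[symmetric])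
  fix A :: "real set" and B assume "A \<in> sets lborel" "B \<in> sets tree_law"
  then have [measurable]: "A \<in> sets borel" "B \<in> sets tree_space" by (auto simp: sets_tree_law)
  have "emeasure M {\<omega> \<in> space M. \<xi> i \<omega> \<in> A \<and> tree i \<omega> \<in> B}
      = emeasure M {\<omega> \<in> space M. \<xi> i \<omega> \<in> A} * emeasure tree_law B" for i
    by (simp add: emeasure_eq_measure tree_law.emeasure_eq_measure prob_point_and_tree_in ennreal_mult)
  moreover have "emeasure lborel A = (\<Sum>i. emeasure M {\<omega> \<in> space M. \<xi> i \<omega> \<in> A})"
    by (simp flip: distr_points_eq_lborel add: emeasure_distr_count_space_pair)
  ultimately show "emeasure lborel A * emeasure tree_law B
      = emeasure (distr (count_space UNIV \<Otimes>\<^sub>M M) (borel \<Otimes>\<^sub>M tree_space) (\<lambda>(i, \<omega>). (\<xi> i \<omega>, tree i \<omega>)))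
          (A \<times> B)"
    by (simp add: emeasure_distr_count_space_pair)
qed (simp_all add: lborel.sigma_finite_measure_axioms tree_law.sigma_finite_measure_axioms
    sets_tree_law cong: sets_pair_measure_cong)

lemma suminf_emeasure_shifted_point_in_ball:
  assumes [measurable]: "Measurable.pred tree_space P" "f \<in> borel_measurable tree_space"
    and a: "0 \<le> a"
  shows "(\<Sum>i. emeasure M {\<omega> \<in> space M. P (tree i \<omega>) \<and> \<bar>\<xi> i \<omega> + f (tree i \<omega>)\<bar> < a})
    = ennreal (2 * a) * emeasure tree_law {x \<in> space tree_law. P x}"
proof -
  interpret P: pair_sigma_finite lborel tree_law ..
  define Q where "Q = {y \<in> space (borel \<Otimes>\<^sub>M tree_space). P (snd y) \<and> \<bar>fst y + f (snd y)\<bar> < a}"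
  have Q: "Q \<in> sets (borel \<Otimes>\<^sub>M tree_space)" unfolding Q_def by measurable
  have "(\<Sum>i. emeasure M {\<omega> \<in> space M. P (tree i \<omega>) \<and> \<bar>\<xi> i \<omega> + f (tree i \<omega>)\<bar> < a})
      = (\<Sum>i. emeasure M {\<omega> \<in> space M. (\<xi> i \<omega>, tree i \<omega>) \<in> Q})"
    by (simp add: Q_def space_pair_measure space_PiM)
  also have "\<dots> = emeasure (lborel \<Otimes>\<^sub>M tree_law) Q"
    using Q by (simp flip: campbell add: emeasure_distr_count_space_pair)
  also have "\<dots> = (\<integral>\<^sup>+x. emeasure lborel ((\<lambda>y. (y, x)) -` Q) \<partial>tree_law)"
    using Q
    by (intro P.emeasure_pair_measure_alt2) (simp cong: sets_pair_measure_cong add: sets_tree_law)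
  also have "\<dots> = (\<integral>\<^sup>+x. ennreal (2 * a) * indicator {x \<in> space tree_law. P x} x \<partial>tree_law)"
  proof (rule nn_integral_cong)
    fix x
    have "(\<lambda>y. (y, x)) -` Q = (if P x then {- a - f x<..<a - f x} else {})"
      by (auto simp: Q_def space_pair_measure space_PiM abs_less_iff)
    then show "emeasure lborel ((\<lambda>y. (y, x)) -` Q)
        = ennreal (2 * a) * indicator {x \<in> space tree_law. P x} x"
      using a by (simp add: space_tree_law indicator_def)
  qed
  also have "\<dots> = ennreal (2 * a) * emeasure tree_law {x \<in> space tree_law. P x}"
    by (rule nn_integral_cmult_indicator) measurable
  finally show ?thesis .
qed

lemma emeasure_displaced_particle_in_ball_le:
  assumes [measurable]: "S \<in> sets borel" and a: "0 \<le> a"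
  shows "emeasure M {\<omega> \<in> space M. \<exists>i. \<exists>v\<in>tree_gen n (tree i \<omega>).
      tree_disp v (tree i \<omega>) \<in> S \<and> \<bar>\<xi> i \<omega> + tree_disp v (tree i \<omega>)\<bar> < a}
    \<le> ennreal (2 * a) * (offspring_mean ^ n * emeasure (random_walk_law \<mu> n) S)"
proof -
  define E where "E v i = {\<omega> \<in> space M. (v \<in> tree_gen n (tree i \<omega>) \<and> tree_disp v (tree i \<omega>) \<in> S)
      \<and> \<bar>\<xi> i \<omega> + tree_disp v (tree i \<omega>)\<bar> < a}" for v i
  have E [measurable]: "E v i \<in> events" for v i unfolding E_def by measurable
  have "{\<omega> \<in> space M. \<exists>i. \<exists>v\<in>tree_gen n (tree i \<omega>).
      tree_disp v (tree i \<omega>) \<in> S \<and> \<bar>\<xi> i \<omega> + tree_disp v (tree i \<omega>)\<bar> < a}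
    = (\<Union>v\<in>{v. length v = n}. \<Union>i. E v i)"
    by (auto simp: E_def tree_gen_def)
  also have "emeasure M \<dots> \<le> (\<integral>\<^sup>+v. emeasure M (\<Union>i. E v i) \<partial>count_space {v. length v = n})"
    by (intro emeasure_UN_countable_le) auto
  also have "\<dots> \<le> (\<integral>\<^sup>+v. (\<Sum>i. emeasure M (E v i)) \<partial>count_space {v. length v = n})"
    by (intro nn_integral_mono emeasure_subadditive_countably) auto
  also have "\<dots> = (\<integral>\<^sup>+v. ennreal (2 * a)
      * emeasure tree_law {x \<in> space tree_law. v \<in> tree_gen n x \<and> tree_disp v x \<in> S}
      \<partial>count_space {v. length v = n})"
    unfolding E_def using a
    by (intro nn_integral_cong suminf_emeasure_shifted_point_in_ball) measurable
  also have "\<dots>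
      = ennreal (2 * a) * (offspring_mean ^ n * emeasure (random_walk_law \<mu> n) S)"
    by (simp add: nn_integral_cmult many_to_one)
  finally show ?thesis .
qed

end

subsection \<open>Empty balls\<close>

lemma tendsto_sandwich_limits:
  fixes f :: "'a \<Rightarrow> 'b :: order_topology"
  assumes "G \<noteq> bot"
    and "\<forall>\<^sub>F \<epsilon> in G. (lower \<epsilon> \<longlongrightarrow> l \<epsilon>) F" "\<forall>\<^sub>F \<epsilon> in G. (upper \<epsilon> \<longlongrightarrow> u \<epsilon>) F"
    and "\<forall>\<^sub>F \<epsilon> in G. \<forall>\<^sub>F x in F. lower \<epsilon> x \<le> f x \<and> f x \<le> upper \<epsilon> x"
    and "(l \<longlongrightarrow> c) G" "(u \<longlongrightarrow> c) G"
  shows "(f \<longlongrightarrow> c) F"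
proof (rule order_tendstoI)
  fix b assume "b < c"
  then have "\<forall>\<^sub>F \<epsilon> in G. b < l \<epsilon>" by (rule order_tendstoD(1)[OF assms(5)])
  with assms(2,4) have "\<forall>\<^sub>F \<epsilon> in G. \<forall>\<^sub>F x in F. b < f x"
  proof eventually_elim
    case (elim \<epsilon>)
    from order_tendstoD(1)[OF elim(1,3)] elim(2) show ?case
      by eventually_elim auto
  qed
  then show "\<forall>\<^sub>F x in F. b < f x" using assms(1) by (auto dest: eventually_happens)
next
  fix b assume "c < b"
  then have "\<forall>\<^sub>F \<epsilon> in G. u \<epsilon> < b" by (rule order_tendstoD(2)[OF assms(6)])
  with assms(3,4) have "\<forall>\<^sub>F \<epsilon> in G. \<forall>\<^sub>F x in F. f x < b"
  proof eventually_elim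
    case (elim \<epsilon>)
    from order_tendstoD(2)[OF elim(1,3)] elim(2) show ?case
      by eventually_elim auto
  qed
  then show "\<forall>\<^sub>F x in F. f x < b" using assms(1) by (auto dest: eventually_happens)
qed

lemma brw_R_ge_iff:
  assumes a: "0 < a"
  shows "ereal a \<le> brw_R \<xi> K D n \<omega>
    \<longleftrightarrow> (\<forall>i. \<forall>v\<in>gen_particles K i n \<omega>. a \<le> \<bar>particle_pos \<xi> D i v \<omega>\<bar>)"
proof -
  have Z: "brw_Z \<xi> K D n \<omega> (ball 0 u) = 0
      \<longleftrightarrow> (\<forall>i. \<forall>v\<in>gen_particles K i n \<omega>. u \<le> \<bar>particle_pos \<xi> D i v \<omega>\<bar>)" for u
    by (auto simp: brw_Z_def emeasure_count_space_eq_0 not_less)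
  show ?thesis
  proof
    assume le: "ereal a \<le> brw_R \<xi> K D n \<omega>"
    show "\<forall>i. \<forall>v\<in>gen_particles K i n \<omega>. a \<le> \<bar>particle_pos \<xi> D i v \<omega>\<bar>"
    proof (intro allI ballI)
      fix i v assume "v \<in> gen_particles K i n \<omega>"
      then have "brw_R \<xi> K D n \<omega> \<le> ereal \<bar>particle_pos \<xi> D i v \<omega>\<bar>"
        unfolding brw_R_def Z by (intro Sup_least) auto
      with le have "ereal a \<le> ereal \<bar>particle_pos \<xi> D i v \<omega>\<bar>" by (rule order_trans)
      then show "a \<le> \<bar>particle_pos \<xi> D i v \<omega>\<bar>" by simp
    qed
  next
    assume "\<forall>i. \<forall>v\<in>gen_particles K i n \<omega>. a \<le> \<bar>particle_pos \<xi> D i v \<omega>\<bar>"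
    then show "ereal a \<le> brw_R \<xi> K D n \<omega>"
      unfolding brw_R_def Z using a by (intro Sup_upper) auto
  qed
qed

context poisson_forest
begin

definition empty_ball :: "nat \<Rightarrow> real \<Rightarrow> 'a set" where
  "empty_ball n a
      = {\<omega> \<in> space M. \<forall>i. \<forall>v\<in>tree_gen n (tree i \<omega>). a \<le> \<bar>\<xi> i \<omega> + tree_disp v (tree i \<omega>)\<bar>}"

lemma sets_empty_ball [measurable]: "empty_ball n a \<in> events"
  unfolding empty_ball_def Ball_def by measurable

lemma empty_ball_eq:
  assumes "0 < a"
  shows "empty_ball n a = {\<omega> \<in> space M. ereal a \<le> brw_R \<xi> K D n \<omega>}"
proof -
  have "tree_gen n (tree i \<omega>) = gen_particles K i n \<omega>" for i \<omega>
    by (simp add: tree_gen_def gen_particles_def tree_def)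
  moreover have "\<xi> i \<omega> + tree_disp v (tree i \<omega>) = particle_pos \<xi> D i v \<omega>" for i v \<omega>
    by (simp add: tree_disp_def particle_pos_def tree_def)
  ultimately show ?thesis using assms by (simp add: empty_ball_def brw_R_ge_iff)
qed

end

locale critical_poisson_forest = poisson_forest p \<mu> M \<xi> K D + critical_offspring p
  for p \<mu> and M :: "'a measure" and \<xi> K D
begin

abbreviation walk_tail :: "nat \<Rightarrow> real \<Rightarrow> real" where
  "walk_tail n t \<equiv> measure (random_walk_law \<mu> n) {s. \<bar>s\<bar> > t}"

lemma prob_tree_extinct: "\<P>(x in tree_law. tree_gen n x = {}) = 1 - survival_prob n"
  by (simp add: prob_extinct survival_prob_def)

lemma emeasure_random_walk_law: "emeasure (random_walk_law \<mu> n) S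
    = ennreal (measure (random_walk_law \<mu> n) S)"
proof -
  interpret walk: prob_space "random_walk_law \<mu> n" by (rule step.prob_space_random_walk_law)
  show ?thesis by (rule walk.emeasure_eq_measure)
qed

lemma prob_near_trees_extinct:
  assumes "0 < c"
  shows "\<P>(\<omega> in M. \<forall>i. \<xi> i \<omega> \<in> {- c<..<c} \<longrightarrow> tree_gen n (tree i \<omega>) = {})
    = exp (- survival_prob n * (2 * c))"
proof -
  define extinct where "extinct = {x \<in> space tree_law. tree_gen n x = {}}"
  have extinct: "extinct \<in> sets tree_space"
    unfolding sets_tree_law[symmetric] extinct_def by measurable
  have "\<P>(\<omega> in M. \<forall>i. \<xi> i \<omega> \<in> {- c<..<c} \<longrightarrow> tree i \<omega> \<in> extinct)
      = exp (- (1 - tree_law.prob extinct) * (2 * c))"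
    using assms by (subst prob_trees_rooted_in[OF _ _ _ extinct]) (auto simp: bounded_Ioo)
  moreover have "tree_law.prob extinct = 1 - survival_prob n"
    unfolding extinct_def by (rule prob_tree_extinct)
  ultimately show ?thesis by (simp add: extinct_def space_tree_law)
qed

lemma prob_far_particle_in_ball_le:
  assumes "0 \<le> a"
  shows "\<P>(\<omega> in M. \<exists>i. \<exists>v\<in>tree_gen n (tree i \<omega>). \<bar>tree_disp v (tree i \<omega>)\<bar> > t
      \<and> \<bar>\<xi> i \<omega> + tree_disp v (tree i \<omega>)\<bar> < a) \<le> 2 * a * walk_tail n t"
  using emeasure_displaced_particle_in_ball_le[of "{s. \<bar>s\<bar> > t}" a n] assms
  by (simp add: nn_integral_offspring emeasure_random_walk_law emeasure_eq_measure flip: ennreal_mult)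

text \<open>The ball of radius \<open>a\<close> is empty unless a tree rooted within distance \<open>a + t\<close> survives
  or a particle displaced by more than \<open>t\<close> lands in the ball.\<close>

lemma prob_empty_ball_ge:
  assumes a: "0 < a" and t: "0 \<le> t"
  shows "exp (- survival_prob n * (2 * (a + t))) - 2 * a * walk_tail n t \<le> prob (empty_ball n a)"
proof -
  define near_extinct where "near_extinct
    = {\<omega> \<in> space M. \<forall>i. \<xi> i \<omega> \<in> {- (a + t)<..<a + t} \<longrightarrow> tree_gen n (tree i \<omega>) = {}}"
  define far_in_ball where "far_in_ball = {\<omega> \<in> space M. \<exists>i. \<exists>v\<in>tree_gen n (tree i \<omega>).
      \<bar>tree_disp v (tree i \<omega>)\<bar> > t \<and> \<bar>\<xi> i \<omega> + tree_disp v (tree i \<omega>)\<bar> < a}"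
  have [measurable]: "far_in_ball \<in> events" unfolding far_in_ball_def Bex_def by measurable
  have "near_extinct \<subseteq> empty_ball n a \<union> far_in_ball"
  proof
    fix \<omega> assume \<omega>: "\<omega> \<in> near_extinct"
    have "t < \<bar>tree_disp v (tree i \<omega>)\<bar>"
      if "v \<in> tree_gen n (tree i \<omega>)" "\<bar>\<xi> i \<omega> + tree_disp v (tree i \<omega>)\<bar> < a" for i v
    proof -
      have "\<xi> i \<omega> \<notin> {- (a + t)<..<a + t}" using \<omega> that(1) by (auto simp: near_extinct_def)
      then show ?thesis using that(2) by auto
    qed
    then show "\<omega> \<in> empty_ball n a \<union> far_in_ball"
      using \<omega> by (force simp: near_extinct_def empty_ball_def far_in_ball_def)
  qed
  then have "prob near_extinct \<le> prob (empty_ball n a \<union> far_in_ball)"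
    by (intro finite_measure_mono) auto
  also have "\<dots> \<le> prob (empty_ball n a) + prob far_in_ball" by (intro measure_Un_le) auto
  finally show ?thesis
    using prob_near_trees_extinct[of "a + t" n] prob_far_particle_in_ball_le[of a n t] a t
    unfolding near_extinct_def far_in_ball_def by linarith
qed

lemma prob_all_particles_far_le:
  "\<P>(x in tree_law. \<forall>v\<in>tree_gen n x. \<bar>tree_disp v x\<bar> > t) \<le> 1 - survival_prob n + walk_tail n t"
proof -
  define extinct where "extinct = {x \<in> space tree_law. tree_gen n x = {}}"
  define some_far where "some_far
      = {x \<in> space tree_law. \<exists>v\<in>tree_gen n x. tree_disp v x \<in> {s. \<bar>s\<bar> > t}}"
  have [measurable]: "extinct \<in> sets tree_law" unfolding extinct_def by measurable
  have [measurable]: "some_far \<in> sets tree_law" unfolding some_far_def Bex_def by measurable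
  have "{x \<in> space tree_law. \<forall>v\<in>tree_gen n x. \<bar>tree_disp v x\<bar> > t} \<subseteq> extinct \<union> some_far"
    by (auto simp: extinct_def some_far_def)
  then have "\<P>(x in tree_law. \<forall>v\<in>tree_gen n x. \<bar>tree_disp v x\<bar> > t)
      \<le> tree_law.prob (extinct \<union> some_far)"
    by (intro tree_law.finite_measure_mono) auto
  also have "\<dots> \<le> tree_law.prob extinct + tree_law.prob some_far"
    by (intro measure_Un_le) auto
  also have "tree_law.prob extinct = 1 - survival_prob n"
    unfolding extinct_def by (rule prob_tree_extinct)
  also have "tree_law.prob some_far \<le> walk_tail n t"
    using emeasure_some_particle_disp_le[of "{s. \<bar>s\<bar> > t}" n]
    by (simp add: some_far_def nn_integral_offspring emeasure_random_walk_law
        tree_law.emeasure_eq_measure)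
  finally show ?thesis by simp
qed

text \<open>If the ball of radius \<open>a\<close> is empty, then no tree rooted within distance \<open>a - t\<close> has a
  particle displaced by at most \<open>t\<close>.\<close>

lemma prob_empty_ball_le:
  assumes t: "t < a"
  shows "prob (empty_ball n a) \<le> exp (- (survival_prob n - walk_tail n t) * (2 * (a - t)))"
proof -
  define all_far where "all_far = {x \<in> space tree_law. \<forall>v\<in>tree_gen n x. \<bar>tree_disp v x\<bar> > t}"
  have all_far [measurable]: "all_far \<in> sets tree_space"
    unfolding sets_tree_law[symmetric] all_far_def Ball_def by measurable
  have "t < \<bar>tree_disp v (tree i \<omega>)\<bar>"
    if "\<omega> \<in> empty_ball n a" "\<xi> i \<omega> \<in> {- (a - t)<..<a - t}" "v \<in> tree_gen n (tree i \<omega>)" for \<omega> i v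
  proof -
    have "a \<le> \<bar>\<xi> i \<omega> + tree_disp v (tree i \<omega>)\<bar>" using that by (auto simp: empty_ball_def)
    then show ?thesis using that(2) unfolding greaterThanLessThan_iff by linarith
  qed
  then have "empty_ball n a \<subseteq> {\<omega> \<in> space M. \<forall>i. \<xi> i \<omega> \<in> {- (a - t)<..<a - t} \<longrightarrow> tree i \<omega> \<in> all_far}"
    by (auto simp: all_far_def space_tree_law empty_ball_def)
  then have "prob (empty_ball n a)
      \<le> \<P>(\<omega> in M. \<forall>i. \<xi> i \<omega> \<in> {- (a - t)<..<a - t} \<longrightarrow> tree i \<omega> \<in> all_far)"
    by (rule finite_measure_mono) measurable
  also have "\<dots> = exp (- (1 - tree_law.prob all_far) * (2 * (a - t)))"
    using t by (subst prob_trees_rooted_in[OF _ _ _ all_far]) (auto simp: bounded_Ioo)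
  also have "\<dots> \<le> exp (- (survival_prob n - walk_tail n t) * (2 * (a - t)))"
    using prob_all_particles_far_le[of n t] t by (auto simp: all_far_def intro!: mult_right_mono)
  finally show ?thesis .
qed

lemma tendsto_exp_survival_prob:
  assumes "(\<lambda>n. real n * w n) \<longlonglongrightarrow> 0"
  shows "(\<lambda>n. exp (- (survival_prob n - w n) * (2 * (c * real n)))) \<longlonglongrightarrow> exp (- 4 * c / offspring_var)"
proof -
  have "(\<lambda>n. exp (- 2 * c * (real n * survival_prob n - real n * w n)))
      \<longlonglongrightarrow> exp (- 2 * c * (2 / offspring_var - 0))"
    by (intro tendsto_intros kolmogorov_survival_asymptotics assms)
  then show ?thesis by (simp add: algebra_simps)
qed

theorem tendsto_prob_empty_ball:
  assumes r: "0 < r"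
    and tail: "\<And>\<epsilon>. 0 < \<epsilon> \<Longrightarrow> (\<lambda>n. real n * walk_tail n (\<epsilon> * real n)) \<longlonglongrightarrow> 0"
  shows "(\<lambda>n. prob (empty_ball n (r * real n))) \<longlonglongrightarrow> exp (- 4 * r / offspring_var)"
proof (rule tendsto_sandwich_limits[of "at_right 0"])
  define lower where "lower \<epsilon> n = exp (- survival_prob n * (2 * ((r + \<epsilon>) * real n)))
      - 2 * r * (real n * walk_tail n (\<epsilon> * real n))" for \<epsilon> n
  define upper where "upper \<epsilon> n
    = exp (- (survival_prob n - walk_tail n (\<epsilon> * real n)) * (2 * ((r - \<epsilon>) * real n)))" for \<epsilon> n
  have \<epsilon>: "\<forall>\<^sub>F \<epsilon> in at_right 0. 0 < \<epsilon> \<and> \<epsilon> < r"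
    using r eventually_at_right_real[of 0 r] by simp
  have "lower \<epsilon> \<longlonglongrightarrow> exp (- 4 * (r + \<epsilon>) / offspring_var) - 2 * r * 0" if "0 < \<epsilon>" for \<epsilon>
    unfolding lower_def[abs_def] using tail[OF that] tendsto_exp_survival_prob[of "\<lambda>_. 0" "r + \<epsilon>"]
    by (intro tendsto_diff tendsto_mult tendsto_const) simp_all
  with \<epsilon> show "\<forall>\<^sub>F \<epsilon> in at_right 0. lower \<epsilon> \<longlonglongrightarrow> exp (- 4 * (r + \<epsilon>) / offspring_var)"
    by (auto elim: eventually_mono)
  have "upper \<epsilon> \<longlonglongrightarrow> exp (- 4 * (r - \<epsilon>) / offspring_var)" if "0 < \<epsilon>" for \<epsilon>
    unfolding upper_def[abs_def] using tail[OF that] by (rule tendsto_exp_survival_prob)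
  with \<epsilon> show "\<forall>\<^sub>F \<epsilon> in at_right 0. upper \<epsilon> \<longlonglongrightarrow> exp (- 4 * (r - \<epsilon>) / offspring_var)"
    by (auto elim: eventually_mono)
  have "lower \<epsilon> n \<le> prob (empty_ball n (r * real n)) \<and> prob (empty_ball n (r * real n)) \<le> upper \<epsilon> n"
    if "0 < \<epsilon>" "\<epsilon> < r" "0 < n" for \<epsilon> n
    using prob_empty_ball_ge[of "r * real n" "\<epsilon> * real n" n]
      prob_empty_ball_le[of "\<epsilon> * real n" "r * real n" n] r that
    by (simp add: lower_def upper_def distrib_right left_diff_distrib mult.assoc)
  with \<epsilon> show "\<forall>\<^sub>F \<epsilon> in at_right 0. \<forall>\<^sub>F n in sequentially.
      lower \<epsilon> n \<le> prob (empty_ball n (r * real n)) \<and> prob (empty_ball n (r * real n)) \<le> upper \<epsilon> n"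
    by (auto elim!: eventually_mono intro: eventually_mono[OF eventually_gt_at_top[of 0]])
  have "((\<lambda>\<epsilon>. exp (- 4 * (r + \<epsilon>) / offspring_var)) \<longlongrightarrow> exp (- 4 * (r + 0) / offspring_var)) (at_right 0)"
    "((\<lambda>\<epsilon>. exp (- 4 * (r - \<epsilon>) / offspring_var)) \<longlongrightarrow> exp (- 4 * (r - 0) / offspring_var)) (at_right 0)"
    using offspring_var_pos by (intro tendsto_intros; simp)+
  then show "((\<lambda>\<epsilon>. exp (- 4 * (r + \<epsilon>) / offspring_var)) \<longlongrightarrow> exp (- 4 * r / offspring_var)) (at_right 0)"
    "((\<lambda>\<epsilon>. exp (- 4 * (r - \<epsilon>) / offspring_var)) \<longlongrightarrow> exp (- 4 * r / offspring_var)) (at_right 0)"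
    by simp_all
qed simp

end

theorem theorem1p1:
  fixes M :: "'a measure" and p :: "nat pmf" and \<mu> :: "real measure" and \<alpha> r :: real
    and \<xi> :: "nat \<Rightarrow> 'a \<Rightarrow> real"
    and K :: "nat \<Rightarrow> nat list \<Rightarrow> 'a \<Rightarrow> nat" and D :: "nat \<Rightarrow> nat list \<Rightarrow> 'a \<Rightarrow> real"
  assumes M: "prob_space M"
    and p0: "pmf p 0 < 1" and p1: "pmf p 1 < 1"
    and mean_int: "integrable (measure_pmf p) real"
    and mean1: "measure_pmf.expectation p real = 1"
    and var_fin: "integrable (measure_pmf p) (\<lambda>k. (real k)\<^sup>2)"
    and \<mu>: "prob_space \<mu>" "sets \<mu> = sets borel"
    and X_int: "integrable \<mu> (\<lambda>x. x)" and X_mean: "(\<integral>x. x \<partial>\<mu>) = 0"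
    and \<alpha>: "\<alpha> > 2" and X_mom: "integrable \<mu> (\<lambda>x. \<bar>x\<bar> powr \<alpha>)"
    and Z0: "poisson_point_seq M \<xi>"
    and tree_indep: "prob_space.indep_vars M (\<lambda>_. count_space UNIV \<Otimes>\<^sub>M borel)
                        (\<lambda>(i, v) \<omega>. (K i v \<omega>, D i v \<omega>)) UNIV"
    and tree_law: "\<And>i v. distr M (count_space UNIV \<Otimes>\<^sub>M borel) (\<lambda>\<omega>. (K i v \<omega>, D i v \<omega>))
                        = measure_pmf p \<Otimes>\<^sub>M \<mu>"
    and Z0_tree_indep: "prob_space.indep_set M
        {(\<lambda>\<omega> i. \<xi> i \<omega>) -` S \<inter> space M | S. S \<in> sets (Pi\<^sub>M UNIV (\<lambda>_. borel))}
        {(\<lambda>\<omega> (iv :: nat \<times> nat list). (K (fst iv) (snd iv) \<omega>, D (fst iv) (snd iv) \<omega>)) -` S \<inter> space M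
           | S. S \<in> sets (Pi\<^sub>M UNIV (\<lambda>_. count_space UNIV \<Otimes>\<^sub>M borel))}"
    and r: "r > 0"
  shows "(\<lambda>n. measure M {\<omega> \<in> space M. brw_R \<xi> K D n \<omega> \<ge> ereal (r * real n)})
           \<longlonglongrightarrow> exp (- 4 * r / measure_pmf.variance p real)"
proof -
  interpret critical_poisson_forest p \<mu> M \<xi> K D
    by (intro critical_poisson_forest.intro poisson_forest.intro branching_random_walk.intro
        poisson_forest_axioms.intro real_distribution.intro real_distribution_axioms.intro
        critical_offspring.intro) fact+
  have "\<forall>\<^sub>F n in sequentially. prob (empty_ball n (r * real n))
      = measure M {\<omega> \<in> space M. brw_R \<xi> K D n \<omega> \<ge> ereal (r * real n)}"
    using eventually_gt_at_top[of 0] by eventually_elim (simp add: empty_ball_eq r)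
  moreover have "(\<lambda>n. real n * walk_tail n (\<epsilon> * real n)) \<longlonglongrightarrow> 0" if "0 < \<epsilon>" for \<epsilon>
    using X_int X_mean \<alpha> X_mom that by (rule step.tendsto_random_walk_tail)
  then have "(\<lambda>n. prob (empty_ball n (r * real n))) \<longlonglongrightarrow> exp (- 4 * r / measure_pmf.variance p real)"
    by (rule tendsto_prob_empty_ball[OF r])
  ultimately show ?thesis by (rule Lim_transform_eventually[rotated])
qed

end
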